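(* Let $c>0$ and let $a\in\mathbb{R}$ satisfy $a^2=\dfrac{c}{\cosh^2(1/2)}$. Then the periodic peaked function $$u(x,t)=a\cosh(\zeta),\qquad \zeta=\tfrac12-(x-ct)+[x-ct],$$ is a global periodic weak solution (with initial data $u_0(x)=u(x,0)$) of the Novikov equation $$u_t-u_{xxt}+4u^2u_x-3uu_xu_{xx}-u^2u_{xxx}=0$$ on $\mathbb{S}=\mathbb{R}/\mathbb{Z}$.
   Context: $\mathbb{S}=\mathbb{R}/\mathbb{Z}$; functions on $\mathbb{S}$ are identified with functions on $\mathbb{R}$ of period one. $[x]$ denotes the largest integer not exceeding $x$. Let $G(x)=\dfrac{\cosh(\frac12-x+[x])}{2\sinh(1/2)}$ be the periodic Green function of $1-\partial_x^2$ (i.e. $(1-\partial_x^2)^{-1}f=G*f$), where $(f*g)(x)=\int_{\mathbb{S}}f(y)g(x-y)\,dy$. Definition (periodic weak solution). Given $u_0\in W^{1,3}(\mathbb{S})$, a function $u\in L^\infty_{loc}([0,T),W^{1,3}_{loc}(\mathbb{S}))$ is a periodic weak solution on $[0,T)$ of the Novikov equation with initial data $u_0$ if $$\int_0^T\!\!\int_{\mathbb{S}}\Big[u\,\partial_t\phi+\tfrac13u^3\partial_x\phi+G*\big(u^3+\tfrac32uu_x^2\big)\,\partial_x\phi-G*\big(\tfrac{u_x^3}{2}\big)\,\phi\Big]dx\,dt+\int_{\mathbb{S}}u_0(x)\phi(0,x)\,dx=0$$ for every test function $\phi(t,x)\in C_c^\infty([0,T)\times\mathbb{S})$ (smooth functions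 with compact support in $[0,T)\times\mathbb{S}$, obtained as restrictions of smooth functions on $\mathbb{R}\times\mathbb{S}$). If $u$ is a periodic weak solution on $[0,T)$ for every $T>0$, it is called a global periodic weak solution. *)

theory Defs
  imports "HOL-Analysis.Analysis" "HOL-Library.Periodic_Fun"
begin

text \<open>
  Functions on the circle \<open>\<real>/\<int>\<close> are represented by functions on \<open>\<real>\<close> of period one,
  i.e. functions satisfying \<^const>\<open>periodic_fun_simple'\<close>. They are integrated over the
  period \<open>[0,1]\<close> with respect to Lebesgue measure. Functions of time and space take the time
  argument first.
\<close>

abbreviation circle :: "real measure" where
  "circle \<equiv> lebesgue_on {0..1}"

section \<open>Smooth functions\<close>

primrec times_cont_differentiable ::
  "nat \<Rightarrow> ('a::real_normed_vector \<Rightarrow> 'b::real_normed_vector) \<Rightarrow> bool" where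
  "times_cont_differentiable 0 f \<longleftrightarrow> continuous_on UNIV f"
| "times_cont_differentiable (Suc n) f \<longleftrightarrow>
     (\<forall>x. f differentiable (at x)) \<and>
     (\<forall>v. times_cont_differentiable n (\<lambda>x. frechet_derivative f (at x) v))"

definition smooth :: "('a::real_normed_vector \<Rightarrow> 'b::real_normed_vector) \<Rightarrow> bool" where
  "smooth f \<longleftrightarrow> (\<forall>n. times_cont_differentiable n f)"

section \<open>The Sobolev space \<open>W\<^sup>1\<^sup>,\<^sup>3\<close> of the circle\<close>

definition L3 :: "(real \<Rightarrow> real) set" where
  "L3 = {f. periodic_fun_simple' f \<and> f \<in> borel_measurable circle \<and>
            integrable circle (\<lambda>x. \<bar>f x\<bar> ^ 3)}"

definition is_weak_deriv :: "(real \<Rightarrow> real) \<Rightarrow> (real \<Rightarrow> real) \<Rightarrow> bool" where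
  "is_weak_deriv f g \<longleftrightarrow>
     (\<forall>\<psi>. smooth \<psi> \<and> periodic_fun_simple' \<psi> \<longrightarrow>
        (LINT x|circle. f x * deriv \<psi> x) = - (LINT x|circle. g x * \<psi> x))"

definition W13 :: "(real \<Rightarrow> real) set" where
  "W13 = {f \<in> L3. \<exists>g\<in>L3. is_weak_deriv f g}"

text \<open>
  The weak derivative is unique up to null sets, so that it does not matter which representative
  is selected here: it only occurs under integrals over the circle.
\<close>

definition weak_deriv :: "(real \<Rightarrow> real) \<Rightarrow> real \<Rightarrow> real" where
  "weak_deriv f = (SOME g. g \<in> L3 \<and> is_weak_deriv f g)"

definition W13_norm :: "(real \<Rightarrow> real) \<Rightarrow> real" where
  "W13_norm f = root 3 ((LINT x|circle. \<bar>f x\<bar> ^ 3) + (LINT x|circle. \<bar>weak_deriv f x\<bar> ^ 3))"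

text \<open>
  Strong (Bochner) measurability of a \<open>W\<^sup>1\<^sup>,\<^sup>3\<close>-valued function on \<open>[0,T)\<close>: it is almost everywhere
  the norm limit of simple functions with values in \<open>W\<^sup>1\<^sup>,\<^sup>3\<close>.
\<close>

definition strongly_measurable_W13 :: "real \<Rightarrow> (real \<Rightarrow> real \<Rightarrow> real) \<Rightarrow> bool" where
  "strongly_measurable_W13 T u \<longleftrightarrow>
     (\<exists>s :: nat \<Rightarrow> real \<Rightarrow> real \<Rightarrow> real.
        (\<forall>n. simple_function (lebesgue_on {0..<T}) (s n) \<and> (\<forall>t\<in>{0..<T}. s n t \<in> W13)) \<and>
        (AE t in lebesgue_on {0..<T}. (\<lambda>n. W13_norm (\<lambda>x. s n t x - u t x)) \<longlonglongrightarrow> 0))"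

text \<open>
  The space of locally essentially bounded functions from \<open>[0,T)\<close> to \<open>W\<^sup>1\<^sup>,\<^sup>3\<close>; every compact
  subset of \<open>[0,T)\<close> is contained in some \<open>[0,S]\<close> with \<open>S < T\<close>. Since the circle is compact,
  there is no difference between \<open>W\<^sup>1\<^sup>,\<^sup>3\<close> and its local version.
\<close>

definition Linf_loc_W13 :: "real \<Rightarrow> (real \<Rightarrow> real \<Rightarrow> real) set" where
  "Linf_loc_W13 T = {u.
     (AE t in lebesgue_on {0..<T}. u t \<in> W13) \<and>
     strongly_measurable_W13 T u \<and>
     (\<forall>S\<in>{0..<T}. \<exists>M. AE t in lebesgue_on {0..S}. W13_norm (u t) \<le> M)}"

section \<open>Periodic weak solutions of the Novikov equation\<close>

definition green :: "real \<Rightarrow> real" where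
  "green x = cosh (1/2 - x + of_int \<lfloor>x\<rfloor>) / (2 * sinh (1/2))"

definition circle_conv :: "(real \<Rightarrow> real) \<Rightarrow> (real \<Rightarrow> real) \<Rightarrow> real \<Rightarrow> real" where
  "circle_conv f g x = (LINT y|circle. f y * g (x - y))"

text \<open>
  A test function on \<open>[0,T)\<close> times the circle is given by a smooth extension to \<open>\<real>\<close> times the
  circle; only its restriction to \<open>[0,T)\<close> is required to have compact support. As the circle is
  compact, this means that the support is contained in the product of a compact subset of
  \<open>[0,T)\<close> and the circle.
\<close>

definition test_function :: "real \<Rightarrow> (real \<times> real \<Rightarrow> real) \<Rightarrow> bool" where
  "test_function T \<phi> \<longleftrightarrow>
     smooth \<phi> \<and> (\<forall>t. periodic_fun_simple' (\<lambda>x. \<phi> (t, x))) \<and>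
     (\<exists>K. compact K \<and> K \<subseteq> {0..<T} \<and> (\<forall>t\<in>{0..<T} - K. \<forall>x. \<phi> (t, x) = 0))"

definition periodic_weak_solution ::
  "real \<Rightarrow> (real \<Rightarrow> real) \<Rightarrow> (real \<Rightarrow> real \<Rightarrow> real) \<Rightarrow> bool" where
  "periodic_weak_solution T u0 u \<longleftrightarrow>
     u0 \<in> W13 \<and> u \<in> Linf_loc_W13 T \<and>
     (\<forall>\<phi>. test_function T \<phi> \<longrightarrow>
        (LINT t|lebesgue_on {0..<T}. LINT x|circle.
           u t x * deriv (\<lambda>s. \<phi> (s, x)) t
           + 1/3 * u t x ^ 3 * deriv (\<lambda>y. \<phi> (t, y)) x
           + circle_conv green (\<lambda>y. u t y ^ 3 + 3/2 * u t y * weak_deriv (u t) y ^ 2) x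
               * deriv (\<lambda>y. \<phi> (t, y)) x
           - circle_conv green (\<lambda>y. weak_deriv (u t) y ^ 3 / 2) x * \<phi> (t, x))
        + (LINT x|circle. u0 x * \<phi> (0, x)) = 0)"

definition global_periodic_weak_solution ::
  "(real \<Rightarrow> real) \<Rightarrow> (real \<Rightarrow> real \<Rightarrow> real) \<Rightarrow> bool" where
  "global_periodic_weak_solution u0 u \<longleftrightarrow> (\<forall>T>0. periodic_weak_solution T u0 u)"

end

theory Submission
  imports Defs
begin

text \<open>
  Write \<open>u(t,x) = p(x - ct)\<close> with the periodic profile \<open>p = a cosh s\<close>, \<open>s = 1/2 - z + [z]\<close>. Substituting
  \<open>x = z + ct\<close> turns the space integral at time \<open>t\<close> into an integral over \<open>[0,1]\<close> of explicit smooth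
  functions of \<open>z\<close> against \<open>\<phi>\<close>, \<open>\<phi>\<^sub>t\<close>, \<open>\<phi>\<^sub>x\<close> at \<open>(t, z + ct)\<close>. With
  \<open>A = G * (p\<^sup>3 + 3/2 p p'\<^sup>2)\<close> and \<open>B = G * (p'\<^sup>3/2)\<close> in closed form, the relation between \<open>a\<close> and \<open>c\<close>
  gives \<open>(p\<^sup>3/3 + A - c p)' = - B\<close>, so that after one integration by parts only the time derivative of
  \<open>I(t) = \<integral> p(z) \<phi>(t, z + ct) dz\<close> is left. It integrates to \<open>- I(0)\<close>, which the initial term cancels.
\<close>

section \<open>Uniqueness of weak derivatives\<close>

inductive trig_poly :: "(real \<Rightarrow> real) \<Rightarrow> bool" where
  const: "trig_poly (\<lambda>x. k)"
| cos: "trig_poly (\<lambda>x. cos (2 * pi * x))"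
| sin: "trig_poly (\<lambda>x. sin (2 * pi * x))"
| add: "trig_poly f \<Longrightarrow> trig_poly g \<Longrightarrow> trig_poly (\<lambda>x. f x + g x)"
| mult: "trig_poly f \<Longrightarrow> trig_poly g \<Longrightarrow> trig_poly (\<lambda>x. f x * g x)"

lemma trig_poly_has_derivative:
  assumes "trig_poly f"
  shows "\<exists>f'. trig_poly f' \<and> (\<forall>x. (f has_real_derivative f' x) (at x))"
  using assms
proof induction
  case (const k)
  then show ?case by (intro exI[of _ "\<lambda>x. 0"]) (auto intro: trig_poly.const)
next
  case cos
  show ?case
    by (intro exI[of _ "\<lambda>x. (- (2 * pi)) * sin (2 * pi * x)"] conjI allI
        trig_poly.mult trig_poly.const trig_poly.sin) (auto intro!: derivative_eq_intros)
next
  case sin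
  show ?case
    by (intro exI[of _ "\<lambda>x. (2 * pi) * cos (2 * pi * x)"] conjI allI
        trig_poly.mult trig_poly.const trig_poly.cos) (auto intro!: derivative_eq_intros)
next
  case (add f g)
  then obtain f' g' where "trig_poly f'" "trig_poly g'"
    "\<forall>x. (f has_real_derivative f' x) (at x)" "\<forall>x. (g has_real_derivative g' x) (at x)"
    by blast
  then show ?case
    by (intro exI[of _ "\<lambda>x. f' x + g' x"]) (auto intro!: trig_poly.add derivative_intros)
next
  case (mult f g)
  then obtain f' g' where "trig_poly f'" "trig_poly g'"
    "\<forall>x. (f has_real_derivative f' x) (at x)" "\<forall>x. (g has_real_derivative g' x) (at x)"
    by blast
  with mult show ?case
    by (intro exI[of _ "\<lambda>x. f' x * g x + g' x * f x"])
       (auto intro!: trig_poly.intros(4,5) derivative_eq_intros)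
qed

lemma trig_poly_continuous: "trig_poly f \<Longrightarrow> continuous_on S f"
  using trig_poly_has_derivative[of f] DERIV_isCont continuous_at_imp_continuous_on by blast

text \<open>Induction on the order works for the whole class at once: the Frechet derivative in
  direction \<open>v\<close> is \<open>f' x * v\<close>, again a trigonometric polynomial.\<close>

lemma trig_poly_smooth:
  assumes "trig_poly f" shows "smooth f"
  unfolding smooth_def
proof
  fix n show "times_cont_differentiable n f"
    using assms
  proof (induction n arbitrary: f)
    case 0
    then show ?case by (simp add: trig_poly_continuous)
  next
    case (Suc n)
    then obtain f' where f': "trig_poly f'" "\<And>x. (f has_real_derivative f' x) (at x)"
      using trig_poly_has_derivative by blast
    then have "(f has_derivative (*) (f' x)) (at x)" for x
      by (auto simp: has_field_derivative_def)
    then have "f differentiable (at x)" "frechet_derivative f (at x) = (*) (f' x)" for x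
      by (auto simp: differentiable_def simp flip: frechet_derivative_at)
    moreover have "times_cont_differentiable n (\<lambda>x. f' x * v)" for v
      using Suc.IH f' by (auto intro: trig_poly.intros)
    ultimately show ?case by simp
  qed
qed

lemma trig_poly_periodic: "trig_poly f \<Longrightarrow> periodic_fun_simple' f"
  unfolding periodic_fun_simple'_def
proof (induction rule: trig_poly.induct)
  case cos
  then show ?case by (simp add: distrib_left cos_add)
next
  case sin
  then show ?case by (simp add: distrib_left sin_add)
qed auto

text \<open>A real polynomial on the complex plane is built from real-linear functionals, and on the
  unit circle such a functional is a combination of cosine and sine. This makes Stone-Weierstrass
  approximants admissible as test functions.\<close>

lemma trig_poly_cis:
  assumes "real_polynomial_function F"
  shows "trig_poly (\<lambda>x. F (cis (2 * pi * x)))"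
  using assms
proof induction
  case (linear f)
  interpret bounded_linear f by fact
  have "f (cis (2 * pi * x)) = f 1 * cos (2 * pi * x) + f \<i> * sin (2 * pi * x)" for x
  proof -
    have "cis (2 * pi * x) = cos (2 * pi * x) *\<^sub>R 1 + sin (2 * pi * x) *\<^sub>R \<i>"
      by (auto simp: complex_eq_iff)
    then show ?thesis by (simp add: add scaleR)
  qed
  then show ?case by (simp add: trig_poly.intros)
qed (auto intro: trig_poly.intros)

section \<open>Integrable functions with zero integral against every test function\<close>

lemma integrable_circle_mult_continuous:
  fixes h \<psi> :: "real \<Rightarrow> real"
  assumes "integrable circle h" "continuous_on {0..1} \<psi>"
  shows "integrable circle (\<lambda>x. h x * \<psi> x)"
proof -
  have "bounded (\<psi> ` {0..1})"
    using assms(2) by (intro compact_imp_bounded compact_continuous_image) auto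
  moreover have "\<psi> \<in> borel_measurable circle"
    using assms(2) by (intro continuous_imp_measurable_on_sets_lebesgue) auto
  ultimately have "(\<lambda>x. \<psi> x * h x) absolutely_integrable_on {0..1}"
    using assms(1)
    by (intro absolutely_integrable_bounded_measurable_product_real)
       (auto simp: set_integrable_def integrable_restrict_space)
  then show ?thesis
    by (subst mult.commute) (auto intro: absolutely_integrable_imp_integrable)
qed

text \<open>Trigonometric polynomials are smooth, and by Stone--Weierstrass they approximate \<open>F\<close> on the unit circle.\<close>

lemma integral_mult_continuous_cis_eq_0:
  fixes h :: "real \<Rightarrow> real" and F :: "complex \<Rightarrow> real"
  assumes h: "integrable circle h"
    and zero: "\<And>\<psi>. smooth \<psi> \<Longrightarrow> periodic_fun_simple' \<psi> \<Longrightarrow> (LINT x|circle. h x * \<psi> x) = 0"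
    and F: "continuous_on UNIV F"
  shows "(LINT x|circle. h x * F (cis (2 * pi * x))) = 0"
proof (rule ccontr)
  define I where "I = (LINT x|circle. h x * F (cis (2 * pi * x)))"
  define N where "N = (LINT x|circle. \<bar>h x\<bar>)"
  assume "(LINT x|circle. h x * F (cis (2 * pi * x))) \<noteq> 0"
  then have I: "\<bar>I\<bar> > 0" by (simp add: I_def)
  have N: "N \<ge> 0" by (simp add: N_def)
  \<comment> \<open>The accuracy \<open>e\<close> makes the error \<open>N * e\<close> smaller than
    \<open>\<bar>I\<bar>\<close>; adding 1 keeps the denominator positive when \<open>N\<close> is
    0.\<close>
  define e where "e = \<bar>I\<bar> / (N + 1)"
  have e: "e > 0" using I N by (simp add: e_def)
  obtain g where g: "real_polynomial_function g" "\<And>z. z \<in> sphere 0 1 \<Longrightarrow> \<bar>F z - g z\<bar> < e"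
    using Stone_Weierstrass_real_polynomial_function[OF compact_sphere[of 0 1]
        continuous_on_subset[OF F subset_UNIV] e] by metis
  have tg: "trig_poly (\<lambda>x. g (cis (2 * pi * x)))"
    by (rule trig_poly_cis[OF g(1)])
  have i1: "integrable circle (\<lambda>x. h x * F (cis (2 * pi * x)))"
    by (intro integrable_circle_mult_continuous h continuous_on_compose2[OF F] continuous_intros) auto
  have i2: "integrable circle (\<lambda>x. h x * g (cis (2 * pi * x)))"
    by (intro integrable_circle_mult_continuous h trig_poly_continuous tg)
  have "I = (LINT x|circle. h x * F (cis (2 * pi * x))) - (LINT x|circle. h x * g (cis (2 * pi * x)))"
    using zero[OF trig_poly_smooth[OF tg] trig_poly_periodic[OF tg]] by (simp add: I_def)
  also have "\<dots> = (LINT x|circle. h x * F (cis (2 * pi * x)) - h x * g (cis (2 * pi * x)))"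
    using i1 i2 by simp
  finally have "\<bar>I\<bar> \<le> (LINT x|circle. \<bar>h x * F (cis (2 * pi * x)) - h x * g (cis (2 * pi * x))\<bar>)"
    using integral_abs_bound by metis
  also have "\<dots> \<le> (LINT x|circle. \<bar>h x\<bar> * e)"
  proof (intro integral_mono)
    fix x
    have "\<bar>F (cis (2 * pi * x)) - g (cis (2 * pi * x))\<bar> \<le> e"
      using g(2)[of "cis (2 * pi * x)"] by simp
    then show "\<bar>h x * F (cis (2 * pi * x)) - h x * g (cis (2 * pi * x))\<bar> \<le> \<bar>h x\<bar> * e"
      by (metis abs_ge_zero abs_mult mult_left_mono right_diff_distrib)
  qed (use i1 i2 h in auto)
  also have "\<dots> = N * e" by (simp add: N_def)
  also have "\<dots> < \<bar>I\<bar>"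
    using I N by (simp add: e_def field_simps)
  finally show False by simp
qed

text \<open>The points 0 and 1 have the same image, so one of the two arguments is kept interior.
  For this reason the compact sets below lie in the open interval.\<close>

lemma cis_2pi_eq_iff:
  assumes "x \<in> {0..1}" "y \<in> {0<..<1}" "cis (2 * pi * x) = cis (2 * pi * y)"
  shows "x = y"
proof -
  have "cos (2 * pi * x) = cos (2 * pi * y)" "sin (2 * pi * x) = sin (2 * pi * y)"
    using assms(3) by (simp_all add: complex_eq_iff)
  then obtain n :: int where "2 * pi * x = 2 * pi * y + 2 * pi * of_int n"
    using sin_cos_eq_iff[of "2 * pi * x" "2 * pi * y"] by (auto simp: mult_ac)
  then have n: "x = y + of_int n"
    by (metis distrib_left mult_left_cancel pi_neq_zero mult_eq_0_iff zero_neq_numeral)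
  have "of_int n < (1::real)" "(-1::real) < of_int n"
    using n assms by auto
  then have "n = 0" by linarith
  then show ?thesis using n by simp
qed

text \<open>The indicator of \<open>C\<close> is a pointwise limit of continuous functions of the
  point on the unit circle, whose integrals against \<open>h\<close> vanish. Dominated convergence
  with majorant \<open>\<bar>h\<bar>\<close> carries this over to the limit.\<close>

lemma set_integral_compact_eq_0:
  fixes h :: "real \<Rightarrow> real"
  assumes h: "integrable circle h"
    and zero: "\<And>\<psi>. smooth \<psi> \<Longrightarrow> periodic_fun_simple' \<psi> \<Longrightarrow> (LINT x|circle. h x * \<psi> x) = 0"
    and C: "compact C" "C \<subseteq> {0<..<1}" "C \<noteq> {}"
  shows "(LINT x|circle. h x * indicator C x) = 0"
proof -
  define D where "D = (\<lambda>x. cis (2 * pi * x)) ` C"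
  have D: "closed D" "D \<noteq> {}"
    using C unfolding D_def
    by (auto intro!: compact_imp_closed compact_continuous_image continuous_intros)
  \<comment> \<open>For positive \<open>n\<close> this is a continuous bump, equal to 1 on
    \<open>D\<close> and to 0 at distance at least \<open>1/n\<close> from it.\<close>
  define f where "f n z = max 0 (1 - real n * infdist z D)" for n z
  have f: "continuous_on UNIV (f n)" for n
    unfolding f_def by (intro continuous_intros)
  have f1: "\<bar>f n z\<bar> \<le> 1" for n z
    by (auto simp: f_def infdist_nonneg)
  have m: "(\<lambda>x. h x * f n (cis (2 * pi * x))) \<in> borel_measurable circle" for n
    by (intro borel_measurable_integrable integrable_circle_mult_continuous h
        continuous_on_compose2[OF f] continuous_intros) auto
  have lim: "(\<lambda>n. f n (cis (2 * pi * x))) \<longlonglongrightarrow> indicator C x" if "x \<in> {0..1}" for x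
  proof (cases "x \<in> C")
    case True
    then have "infdist (cis (2 * pi * x)) D = 0"
      by (simp add: D_def infdist_zero)
    then show ?thesis using True by (simp add: f_def)
  next
    case False
    then have "cis (2 * pi * x) \<notin> D"
      using cis_2pi_eq_iff[OF that] C(2) by (auto simp: D_def)
    then have d: "infdist (cis (2 * pi * x)) D > 0"
      using D by (metis in_closed_iff_infdist_zero infdist_nonneg order_le_less)
    obtain m where m: "1 < real m * infdist (cis (2 * pi * x)) D"
      using reals_Archimedean3[OF d] by blast
    have "\<forall>\<^sub>F n in sequentially. f n (cis (2 * pi * x)) = 0"
      using eventually_ge_at_top[of m]
    proof eventually_elim
      case (elim n)
      then have "real m * infdist (cis (2 * pi * x)) D \<le> real n * infdist (cis (2 * pi * x)) D"
        by (intro mult_right_mono) (auto simp: infdist_nonneg)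
      then show ?case using m by (auto simp: f_def)
    qed
    then show ?thesis using False by (simp add: tendsto_eventually)
  qed
  have "(\<lambda>n. LINT x|circle. h x * f n (cis (2 * pi * x))) \<longlonglongrightarrow> (LINT x|circle. h x * indicator C x)"
  proof (rule integral_dominated_convergence)
    have "C \<in> sets lebesgue" using C(1) by (simp add: borel_compact)
    then have "C \<inter> {0..1} \<in> sets lebesgue" by (intro sets.Int) auto
    then have "C \<inter> {0..1} \<in> sets circle" by (auto simp: sets_restrict_space)
    then have "(indicator C :: real \<Rightarrow> real) \<in> borel_measurable circle"
      by (subst borel_measurable_indicator_iff) simp
    then show "(\<lambda>x. h x * indicator C x) \<in> borel_measurable circle"
      using h by auto
    show "integrable circle (\<lambda>x. \<bar>h x\<bar>)" using h by simp
    show "AE x in circle. (\<lambda>n. h x * f n (cis (2 * pi * x))) \<longlonglongrightarrow> h x * indicator C x"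
      by (intro AE_I2 tendsto_intros lim) auto
    show "AE x in circle. norm (h x * f n (cis (2 * pi * x))) \<le> \<bar>h x\<bar>" for n
    proof (intro AE_I2)
      fix x show "norm (h x * f n (cis (2 * pi * x))) \<le> \<bar>h x\<bar>"
        using mult_left_mono[OF f1[of n "cis (2 * pi * x)"], of "\<bar>h x\<bar>"] by (simp add: abs_mult)
    qed
  qed (rule m)
  moreover have "(LINT x|circle. h x * f n (cis (2 * pi * x))) = 0" for n
    by (rule integral_mult_continuous_cis_eq_0[OF h zero f])
  ultimately show ?thesis
    by (simp add: LIMSEQ_const_iff)
qed

text \<open>Inner regularity: compact sets exhaust the set where \<open>h\<close> is positive up to
  small measure, and on each of them a positive function with zero integral forces measure
  zero.\<close>

lemma AE_circle_nonpos:
  fixes h :: "real \<Rightarrow> real"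
  assumes h: "integrable circle h"
    and zero: "\<And>\<psi>. smooth \<psi> \<Longrightarrow> periodic_fun_simple' \<psi> \<Longrightarrow> (LINT x|circle. h x * \<psi> x) = 0"
  shows "AE x in circle. h x \<le> 0"
proof -
  \<comment> \<open>The endpoints are removed so that compact subsets lie in the open interval; they
    return at the end as a null set.\<close>
  define P where "P = {x \<in> {0<..<1}. h x > 0}"
  have "{x \<in> space circle. h x > 0} \<in> sets circle"
    using h by measurable
  then have "{x \<in> {0..1}. h x > 0} \<in> sets lebesgue"
    by (auto simp: sets_restrict_space_iff)
  then have "{x \<in> {0..1}. h x > 0} \<inter> {0<..<1} \<in> sets lebesgue" by (intro sets.Int) auto
  also have "{x \<in> {0..1}. h x > 0} \<inter> {0<..<1} = P" by (auto simp: P_def)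
  finally have P: "P \<in> sets lebesgue" .
  have "emeasure lebesgue P \<le> 0 + ennreal e" if e: "e > 0" for e
  proof -
    obtain T where T: "closed T" "T \<subseteq> P" "P - T \<in> lmeasurable" "emeasure lebesgue (P - T) < ennreal e"
      by (rule sets_lebesgue_inner_closed[OF P e])
    have "T \<subseteq> {0..1}" using T by (auto simp: P_def)
    then have Tc: "compact T"
      using T(1) by (simp add: compact_eq_bounded_closed bounded_subset[OF bounded_closed_interval])
    have TL: "T \<in> sets lebesgue" using T by auto
    have "emeasure lebesgue T = 0"
    proof (cases "T = {}")
      case False
      have T0: "(LINT x|circle. h x * indicator T x) = 0"
        using False T Tc by (intro set_integral_compact_eq_0 h zero) (auto simp: P_def)
      have "T \<in> sets circle" using TL \<open>T \<subseteq> {0..1}\<close> by (auto simp: sets_restrict_space_iff)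
      then have "integrable circle (\<lambda>x. h x * indicator T x)"
        using integrable_real_mult_indicator[OF _ h, of T] by (simp add: mult.commute)
      then have "AE x in circle. h x * indicator T x = 0"
        using T0 T(2) by (subst integral_nonneg_eq_0_iff_AE[symmetric])
          (auto intro!: AE_I2 simp: P_def indicator_def)
      then have "AE x in lebesgue. x \<notin> T"
        using T(2) by (subst (asm) AE_restrict_space_iff) (auto elim!: eventually_mono simp: P_def indicator_def split: if_splits)
      then show ?thesis
        using TL by (simp add: AE_iff_measurable[of T])
    qed auto
    moreover have "emeasure lebesgue P \<le> emeasure lebesgue T + emeasure lebesgue (P - T)"
      using T(2) TL P emeasure_subadditive[of T lebesgue "P - T"] by (simp add: Un_absorb1)
    ultimately show ?thesis using T(4) by simp
  qed
  then have "emeasure lebesgue P \<le> 0"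
    by (rule ennreal_le_epsilon)
  then have "P \<in> null_sets lebesgue" using P by auto
  then have "P \<union> {0,1} \<in> null_sets lebesgue" by (intro null_sets.Un) (auto simp: negligible_iff_null_sets[symmetric])
  then have "AE x in lebesgue. x \<notin> P \<union> {0,1}" by (rule AE_not_in)
  then show ?thesis
    by (subst AE_restrict_space_iff) (simp, erule eventually_mono, force simp: P_def)
qed

lemma AE_circle_eq_0:
  fixes h :: "real \<Rightarrow> real"
  assumes h: "integrable circle h"
    and zero: "\<And>\<psi>. smooth \<psi> \<Longrightarrow> periodic_fun_simple' \<psi> \<Longrightarrow> (LINT x|circle. h x * \<psi> x) = 0"
  shows "AE x in circle. h x = 0"
proof -
  have "AE x in circle. h x \<le> 0" by (rule AE_circle_nonpos[OF assms])
  moreover have "AE x in circle. - h x \<le> 0"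
    using h zero by (intro AE_circle_nonpos) auto
  ultimately show ?thesis by eventually_elim simp
qed

section \<open>Consequences for weak derivatives\<close>

lemma finite_measure_circle: "finite_measure circle"
  by (rule finite_measureI) (simp add: emeasure_restrict_space)

lemma L3_integrable:
  assumes "f \<in> L3" shows "integrable circle f"
proof (rule Bochner_Integration.integrable_bound)
  interpret finite_measure circle by (rule finite_measure_circle)
  show "integrable circle (\<lambda>x. 1 + \<bar>f x\<bar> ^ 3)" using assms by (auto simp: L3_def)
  show "f \<in> borel_measurable circle" using assms by (auto simp: L3_def)
  show "AE x in circle. norm (f x) \<le> norm (1 + \<bar>f x\<bar> ^ 3)"
  proof (intro AE_I2)
    fix x
    have "\<bar>f x\<bar> \<le> 1 + \<bar>f x\<bar> ^ 3"
      using self_le_power[of "\<bar>f x\<bar>" 3] by (cases "1 \<le> \<bar>f x\<bar>") (auto intro: add_increasing2)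
    then show "norm (f x) \<le> norm (1 + \<bar>f x\<bar> ^ 3)" by simp
  qed
qed

lemma smooth_continuous_on: "smooth f \<Longrightarrow> continuous_on S f"
  unfolding smooth_def by (metis continuous_on_subset subset_UNIV times_cont_differentiable.simps(1))

text \<open>The difference of the two candidates is integrable and has zero integral against every
  test function.\<close>

lemma weak_deriv_unique:
  assumes "g1 \<in> L3" "g2 \<in> L3" "is_weak_deriv f g1" "is_weak_deriv f g2"
  shows "AE x in circle. g1 x = g2 x"
proof -
  have "AE x in circle. g1 x - g2 x = 0"
  proof (rule AE_circle_eq_0)
    show "integrable circle (\<lambda>x. g1 x - g2 x)"
      using assms by (auto intro: L3_integrable)
    fix \<psi> :: "real \<Rightarrow> real" assume \<psi>: "smooth \<psi>" "periodic_fun_simple' \<psi>"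
    have "(LINT x|circle. g1 x * \<psi> x) = (LINT x|circle. g2 x * \<psi> x)"
      using assms(3)[unfolded is_weak_deriv_def, rule_format, of \<psi>]
        assms(4)[unfolded is_weak_deriv_def, rule_format, of \<psi>] \<psi> by simp
    moreover have "integrable circle (\<lambda>x. g1 x * \<psi> x)" "integrable circle (\<lambda>x. g2 x * \<psi> x)"
      using assms \<psi> by (auto intro!: integrable_circle_mult_continuous smooth_continuous_on L3_integrable[of g1] L3_integrable[of g2])
    ultimately show "(LINT x|circle. (g1 x - g2 x) * \<psi> x) = 0"
      by (simp add: left_diff_distrib)
  qed
  then show ?thesis by simp
qed

text \<open>Controls the choice made by \<open>SOME\<close>: under integrals the selected
  representative can be replaced by any explicit weak derivative in \<open>L3\<close>.\<close>

lemma weak_deriv_AE: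
  assumes "g \<in> L3" "is_weak_deriv f g"
  shows "weak_deriv f \<in> L3" "AE x in circle. weak_deriv f x = g x"
proof -
  have "weak_deriv f \<in> L3 \<and> is_weak_deriv f (weak_deriv f)"
    unfolding weak_deriv_def by (rule someI[of _ g]) (use assms in auto)
  then show "weak_deriv f \<in> L3" "AE x in circle. weak_deriv f x = g x"
    using weak_deriv_unique assms by auto
qed

section \<open>Integrals over the circle\<close>

lemma periodic_add_of_int:
  fixes f :: "real \<Rightarrow> 'b"
  assumes "periodic_fun_simple' f"
  shows "f (x + of_int n) = f x"
proof -
  interpret periodic_fun_simple' f by fact
  show ?thesis using plus_of_int[of x n] by (simp add: add.commute)
qed

lemma periodic_shift: "periodic_fun_simple' f \<Longrightarrow> periodic_fun_simple' (\<lambda>x. f (x + \<tau> :: real))"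
  unfolding periodic_fun_simple'_def by (simp add: add.commute[of _ \<tau>] flip: add.assoc)

text \<open>Only the fractional part \<open>r\<close> of the shift matters. The window from
  \<open>r\<close> to \<open>1 + r\<close> is cut at 1 and its right piece is moved back by one
  period.\<close>

lemma periodic_has_integral_shift:
  fixes f :: "real \<Rightarrow> real"
  assumes f: "periodic_fun_simple' f" and int: "f integrable_on {0..1}"
  shows "((\<lambda>x. f (x + \<tau>)) has_integral integral {0..1} f) {0..1}"
proof -
  define r where "r = frac \<tau>"
  have r: "0 \<le> r" "r \<le> 1"
    using frac_lt_1[of \<tau>] by (auto simp: r_def)
  have "f (x + \<tau>) = f (x + r)" for x
    using periodic_add_of_int[OF f, of "x + r" "\<lfloor>\<tau>\<rfloor>"] by (simp add: r_def frac_def algebra_simps)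
  then have eq: "(\<lambda>x. f (x + \<tau>)) = (\<lambda>x. f (x + r))" by auto
  have f1: "(\<lambda>x. f (x - 1)) = f"
    using periodic_add_of_int[OF f, of _ "- 1"] by auto
  have i: "f integrable_on {0..r}" "f integrable_on {r..1}"
    using int r by (auto intro: integrable_on_subinterval)
  have "(f has_integral integral {0..r} f) {1..1 + r}"
    using has_integral_shift_real_ivl[OF integrable_integral[OF i(1)], of "-1"] f1
    by (simp add: add.commute)
  then have "(f has_integral (integral {r..1} f + integral {0..r} f)) {r..1 + r}"
    using r by (intro has_integral_combine[OF _ _ integrable_integral[OF i(2)]]) auto
  moreover have "integral {r..1} f + integral {0..r} f = integral {0..1} f"
    using Henstock_Kurzweil_Integration.integral_combine[OF r int] by simp
  ultimately show ?thesis
    unfolding eq using has_integral_shift_real_ivl[of f _ r "1 + r" r] by simp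
qed

text \<open>Here \<open>f\<close> is given through the floor function and \<open>F\<close> is its
  smooth formula on one period. They can differ only at the point 1, so the integral of any
  translate becomes that of an explicit continuous function.\<close>

lemma periodic_circle_integral_shift:
  fixes f F :: "real \<Rightarrow> real"
  assumes f: "periodic_fun_simple' f"
    and F: "continuous_on {0..1} F" "\<And>z. z \<in> {0..<1} \<Longrightarrow> f z = F z"
  shows "integrable circle (\<lambda>x. f (x + \<tau>))"
    and "(LINT x|circle. f (x + \<tau>)) = integral {0..1} F"
proof -
  have "F absolutely_integrable_on {0..1}"
    using F(1) by (intro absolutely_integrable_continuous_real)
  then have "f absolutely_integrable_on {0..1}"
    by (rule absolutely_integrable_spike[where S = "{1}"]) (use F in auto)
  then have i: "f integrable_on {0..1}" "(\<lambda>x. \<bar>f x\<bar>) integrable_on {0..1}"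
    by (auto simp: absolutely_integrable_on_def)
  have "periodic_fun_simple' (\<lambda>x. \<bar>f x\<bar>)"
    using f by (simp add: periodic_fun_simple'_def)
  then have "(\<lambda>x. f (x + \<tau>)) absolutely_integrable_on {0..1}"
    unfolding absolutely_integrable_on_def
    using periodic_has_integral_shift[OF f i(1), of \<tau>]
      periodic_has_integral_shift[OF _ i(2), of \<tau>] by auto
  then show I: "integrable circle (\<lambda>x. f (x + \<tau>))"
    by (rule absolutely_integrable_imp_integrable) auto
  have "(LINT x|circle. f (x + \<tau>)) = integral {0..1} (\<lambda>x. f (x + \<tau>))"
    by (rule lebesgue_integral_eq_integral[OF I]) auto
  also have "\<dots> = integral {0..1} f"
    using periodic_has_integral_shift[OF f i(1)] by (rule integral_unique)
  also have "\<dots> = integral {0..1} F"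
    by (rule integral_spike[where S = "{1}"]) (use F in auto)
  finally show "(LINT x|circle. f (x + \<tau>)) = integral {0..1} F" .
qed

section \<open>Null sets on the circle\<close>

lemma AE_circle_iff_negligible: "(AE x in circle. P x) \<longleftrightarrow> negligible {x \<in> {0..1}. \<not> P x}"
proof -
  have "(AE x in circle. P x) \<longleftrightarrow> (AE x in lebesgue. x \<in> {0..1} \<longrightarrow> P x)"
    by (rule AE_restrict_space_iff) auto
  also have "\<dots> \<longleftrightarrow> (\<exists>N\<in>null_sets lebesgue. {x \<in> {0..1}. \<not> P x} \<subseteq> N)"
    by (simp add: eventually_ae_filter)
  also have "\<dots> \<longleftrightarrow> negligible {x \<in> {0..1}. \<not> P x}"
    by (meson negligible_iff_null_sets negligible_subset subset_refl)
  finally show ?thesis .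
qed

lemma circle_integral_AE_eq:
  fixes f g :: "real \<Rightarrow> real"
  assumes ae: "AE x in circle. f x = g x" and g: "integrable circle g"
  shows "integrable circle f" and "(LINT x|circle. f x) = (LINT x|circle. g x)"
proof -
  have N: "negligible {x \<in> {0..1}. f x \<noteq> g x}"
    using ae by (simp add: AE_circle_iff_negligible)
  have "g absolutely_integrable_on {0..1}"
    using g by (simp add: set_integrable_def integrable_restrict_space)
  then have "f absolutely_integrable_on {0..1}"
    by (rule absolutely_integrable_spike[OF _ N]) auto
  then show f: "integrable circle f"
    by (rule absolutely_integrable_imp_integrable) auto
  show "(LINT x|circle. f x) = (LINT x|circle. g x)"
    using f g ae by (intro integral_cong_AE) auto
qed

text \<open>A convolution evaluates its second factor at \<open>w - y\<close>, outside the period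
  where equality is known. The new exceptional set lies in countably many reflected integer
  translates of \<open>N\<close>.\<close>

lemma AE_circle_reflect:
  fixes f g :: "real \<Rightarrow> real"
  assumes per: "periodic_fun_simple' f" "periodic_fun_simple' g"
    and ae: "AE x in circle. f x = g x"
  shows "AE y in circle. f (w - y) = g (w - y)"
proof -
  define N where "N = {x \<in> {0..1}. f x \<noteq> g x}"
  have N: "negligible N"
    using ae by (simp add: N_def AE_circle_iff_negligible)
  have "negligible {y \<in> UNIV. w - of_int n - y \<in> N}" for n
    by (rule negligible_differentiable_vimage[OF N, of _ "\<lambda>_. uminus"])
       (auto intro!: derivative_eq_intros)
  then have "negligible (\<Union>n::int. {y. w - of_int n - y \<in> N})"
    by (intro negligible_countable_Union) auto
  moreover have "{y \<in> {0..1}. f (w - y) \<noteq> g (w - y)} \<subseteq> (\<Union>n::int. {y. w - of_int n - y \<in> N})"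
  proof
    fix y assume y: "y \<in> {y \<in> {0..1}. f (w - y) \<noteq> g (w - y)}"
    define z where "z = frac (w - y)"
    have z: "z \<in> {0..1}" "w - y = z + of_int \<lfloor>w - y\<rfloor>"
      using frac_lt_1[of "w - y"] by (auto simp: z_def frac_def less_imp_le)
    have "f (z + of_int \<lfloor>w - y\<rfloor>) \<noteq> g (z + of_int \<lfloor>w - y\<rfloor>)"
      using y z(2) by simp
    then have "f z \<noteq> g z"
      by (simp add: periodic_add_of_int[OF per(1)] periodic_add_of_int[OF per(2)])
    moreover have "w - of_int \<lfloor>w - y\<rfloor> - y = z"
      using z(2) by linarith
    ultimately have "w - of_int \<lfloor>w - y\<rfloor> - y \<in> N"
      using z(1) by (simp add: N_def)
    then show "y \<in> (\<Union>n::int. {y. w - of_int n - y \<in> N})" by blast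
  qed
  ultimately show ?thesis
    unfolding AE_circle_iff_negligible by (rule negligible_subset)
qed

section \<open>Convolution with the Green function\<close>

lemma green_eq: "0 \<le> y \<Longrightarrow> y \<le> 1 \<Longrightarrow> green y = cosh (1/2 - y) / (2 * sinh (1/2))"
proof (cases "y = 1")
  \<comment> \<open>At 1 the floor jumps, but both formulas agree there because cosh is
    even.\<close>
  case True
  then show ?thesis
    using cosh_minus[of "1/2 :: real"] by (simp add: green_def)
next
  case False
  assume "0 \<le> y" "y \<le> 1"
  with False have "\<lfloor>y\<rfloor> = 0" by (simp add: floor_eq_iff)
  then show ?thesis by (simp add: green_def)
qed

text \<open>
  The integrand has the antiderivative \<open>H(y) F'(z - y) + H'(y) F(z - y)\<close> with
  \<open>H(y) = cosh (1/2 - y)\<close> on either side of the jump at \<open>y = z\<close>.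
\<close>

lemma circle_conv_green:
  fixes f F G P :: "real \<Rightarrow> real"
  assumes f: "periodic_fun_simple' f" "AE y in circle. f y = P (frac (y + \<tau>))"
    and P: "continuous_on UNIV P"
    and F: "\<And>z. (F has_real_derivative G z) (at z)"
    and G: "\<And>z. (G has_real_derivative F z - P z) (at z)"
    and bd: "F 0 = F 1" "G 0 = G 1"
  shows "circle_conv green f x = F (frac (x + \<tau>))"
proof -
  \<comment> \<open>An exact representative of the unshifted profile; \<open>f\<close> itself agrees
    with its translate only almost everywhere.\<close>
  define f0 where "f0 z = P (frac z)" for z
  have f0: "periodic_fun_simple' f0" by (simp add: f0_def periodic_fun_simple'_def frac_1_eq)
  have f0P: "f0 z = P z" if "z \<in> {0..<1}" for z
    using that frac_eq[of z] by (simp add: f0_def)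
  define z where "z = frac (x + \<tau>)"
  have z: "0 \<le> z" "z < 1" using frac_lt_1[of "x + \<tau>"] by (auto simp: z_def)
  define E where "E w y = cosh (1/2 - y) * G (w - y) - sinh (1/2 - y) * F (w - y)" for w y
  have E: "(E w has_real_derivative cosh (1/2 - y) * P (w - y)) (at y)" for w y
  proof -
    have "((\<lambda>y. G (w - y)) has_real_derivative - (F (w - y) - P (w - y))) (at y)"
      by (rule DERIV_chain2[where f = G and g = "\<lambda>y. w - y" and Db = "- 1", OF G, THEN DERIV_cong])
        (auto intro!: derivative_eq_intros)
    moreover have "((\<lambda>y. F (w - y)) has_real_derivative - G (w - y)) (at y)"
      by (rule DERIV_chain2[where f = F and g = "\<lambda>y. w - y" and Db = "- 1", OF F, THEN DERIV_cong])
        (auto intro!: derivative_eq_intros)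
    ultimately show ?thesis
      unfolding E_def by (auto intro!: derivative_eq_intros simp: algebra_simps)
  qed
  have hi: "((\<lambda>y. cosh (1/2 - y) * P (w - y)) has_integral (E w b - E w a)) {a..b}" if "a \<le> b" for a b w
    using that E by (intro fundamental_theorem_of_calculus)
      (auto simp: has_real_derivative_iff_has_vector_derivative[symmetric] intro: DERIV_subset)
  define g where "g y = green y * f0 (z - y)" for y
  define k where "k = 2 * sinh (1/2 :: real)"
  have k: "k > 0" by (simp add: k_def)
  have per: "f0 (y + of_int n) = f0 y" for y n
    by (rule periodic_add_of_int[OF f0])
  have g1: "g y = (cosh (1/2 - y) * P (z - y)) / k" if "y \<in> {0..z}" for y
    using that z f0P[of "z - y"] green_eq[of y] by (auto simp: g_def k_def)
  \<comment> \<open>Beyond \<open>z\<close> the argument \<open>z - y\<close> is negative, so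
    periodicity moves it up by 1 before \<open>P\<close> applies. At \<open>y = z\<close> itself
    this would give \<open>P 1\<close> instead of \<open>P 0\<close>, hence the exclusion.\<close>
  have g2: "g y = (cosh (1/2 - y) * P (z + 1 - y)) / k" if "y \<in> {z..1} - {z}" for y
    using that z f0P[of "z + 1 - y"] green_eq[of y] per[of "z - y" 1] by (auto simp: g_def k_def algebra_simps)
  have h1: "(g has_integral (E z z - E z 0) / k) {0..z}"
    using has_integral_divide[OF hi[of 0 z z], of k] z g1
    by (subst has_integral_cong[OF g1]) auto
  have h2: "(g has_integral (E (z + 1) 1 - E (z + 1) z) / k) {z..1}"
    using has_integral_divide[OF hi[of z 1 "z + 1"], of k] z
    by (intro has_integral_spike[OF negligible_sing[of z] g2]) auto
  have h: "(g has_integral (E z z - E z 0) / k + (E (z + 1) 1 - E (z + 1) z) / k) {0..1}"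
    using z by (intro has_integral_combine[OF _ _ h1 h2]) auto
  \<comment> \<open>By \<open>bd\<close> the values \<open>E z z\<close> and
    \<open>E (z + 1) z\<close> cancel. In the remaining ones the cosh terms cancel by evenness, and
    the sinh terms add up to \<open>k * F z\<close>.\<close>
  have "(E z z - E z 0) / k + (E (z + 1) 1 - E (z + 1) z) / k = F z"
    using k bd by (simp add: E_def k_def field_simps)
  with h have gF: "(g has_integral F z) {0..1}" by simp
  have ac: "(\<lambda>y. (cosh (1/2 - y) * P (w - y)) / k) absolutely_integrable_on {a..b}" for a b w
    by (intro absolutely_integrable_continuous_real continuous_intros
        continuous_on_compose2[OF P]) (use k in auto)
  have "g absolutely_integrable_on {0..z}"
    by (rule absolutely_integrable_spike[OF ac[where w = z] negligible_empty]) (use g1 in auto)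
  moreover have "g absolutely_integrable_on {z..1}"
    by (rule absolutely_integrable_spike[OF ac[where w = "z + 1"] negligible_sing[of z]]) (use g2 in auto)
  ultimately have "g absolutely_integrable_on {0..1}"
    using z(1) less_imp_le[OF z(2)] by (rule absolutely_integrable_on_combine)
  then have gi: "integrable circle g"
    by (rule absolutely_integrable_imp_integrable) auto
  have "periodic_fun_simple' (\<lambda>y. f0 (y + \<tau>))"
    by (rule periodic_shift[OF f0])
  then have "AE y in circle. f (x - y) = f0 (x - y + \<tau>)"
    using f(2)[folded f0_def] by (rule AE_circle_reflect[OF f(1)])
  moreover have "f0 (x - y + \<tau>) = f0 (z - y)" for y
    using per[of "z - y" "\<lfloor>x + \<tau>\<rfloor>"] by (simp add: z_def frac_def algebra_simps)
  ultimately have "AE y in circle. green y * f (x - y) = g y"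
    by (auto simp: g_def)
  then have "circle_conv green f x = (LINT y|circle. g y)"
    unfolding circle_conv_def by (rule circle_integral_AE_eq(2)) (rule gi)
  also have "\<dots> = F z"
    using lebesgue_integral_eq_integral[OF gi] gF by (simp add: integral_unique)
  finally show ?thesis by (simp add: z_def)
qed

section \<open>Weak derivatives and \<open>W\<^sup>1\<^sup>,\<^sup>3\<close>-norms\<close>

lemma smooth_real_deriv:
  fixes \<psi> :: "real \<Rightarrow> real"
  assumes "smooth \<psi>"
  shows "(\<psi> has_real_derivative deriv \<psi> x) (at x)" "continuous_on S (deriv \<psi>)"
proof -
  have *: "times_cont_differentiable 1 \<psi>"
    using assms by (auto simp: smooth_def)
  then have d: "\<psi> differentiable (at x)" for x by simp
  then show **: "(\<psi> has_real_derivative deriv \<psi> x) (at x)" for x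
    by (metis DERIV_imp_deriv real_differentiable_def)
  have "continuous_on UNIV (\<lambda>x. frechet_derivative \<psi> (at x) 1)"
    using * by simp
  moreover have "frechet_derivative \<psi> (at x) = (*) (deriv \<psi> x)" for x
    using **[of x] by (simp add: has_field_derivative_def flip: frechet_derivative_at)
  ultimately show "continuous_on S (deriv \<psi>)"
    by (auto intro: continuous_on_subset)
qed

lemma L3_shift:
  fixes f F :: "real \<Rightarrow> real"
  assumes f: "periodic_fun_simple' f"
    and F: "continuous_on {0..1} F" "\<And>z. z \<in> {0..<1} \<Longrightarrow> f z = F z"
  shows "(\<lambda>x. f (x + \<tau>)) \<in> L3"
proof -
  have "integrable circle (\<lambda>x. f (x + \<tau>))"
    by (rule periodic_circle_integral_shift(1)[OF f F])
  moreover have "integrable circle (\<lambda>x. (\<lambda>x. \<bar>f x\<bar> ^ 3) (x + \<tau>))"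
    by (rule periodic_circle_integral_shift(1)[where F = "\<lambda>z. \<bar>F z\<bar> ^ 3"])
       (use f F in \<open>auto simp: periodic_fun_simple'_def intro!: continuous_intros\<close>)
  ultimately show ?thesis
    using periodic_shift[OF f] by (auto simp: L3_def)
qed

lemma integral_by_parts_0_1:
  fixes F G \<psi> \<eta> :: "real \<Rightarrow> real"
  assumes F: "\<And>z. (F has_real_derivative G z) (at z)" and G: "continuous_on {0..1} G"
    and \<psi>: "\<And>z. (\<psi> has_real_derivative \<eta> z) (at z)" and \<eta>: "continuous_on {0..1} \<eta>"
    and bd: "F 0 * \<psi> 0 = F 1 * \<psi> 1"
  shows "integral {0..1} (\<lambda>z. F z * \<eta> z) = - integral {0..1} (\<lambda>z. G z * \<psi> z)"
proof -
  have c: "continuous_on {0..1} F" "continuous_on {0..1} \<psi>"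
    by (metis F \<psi> DERIV_continuous_on has_field_derivative_at_within)+
  have i: "(\<lambda>z. F z * \<eta> z) integrable_on {0..1}" "(\<lambda>z. G z * \<psi> z) integrable_on {0..1}"
    by (intro integrable_continuous_interval continuous_intros c G \<eta>)+
  have "((\<lambda>z. G z * \<psi> z + F z * \<eta> z) has_integral (F 1 * \<psi> 1 - F 0 * \<psi> 0)) {0..1}"
  proof (intro fundamental_theorem_of_calculus)
    fix z
    show "((\<lambda>z. F z * \<psi> z) has_vector_derivative G z * \<psi> z + F z * \<eta> z) (at z within {0..1})"
      unfolding has_real_derivative_iff_has_vector_derivative[symmetric]
      using DERIV_mult[OF F[of z] \<psi>[of z]]
      by (auto simp: algebra_simps intro: has_field_derivative_at_within)
  qed simp
  then have "integral {0..1} (\<lambda>z. G z * \<psi> z + F z * \<eta> z) = 0"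
    using bd by (simp add: integral_unique)
  then show ?thesis
    using i by (simp add: Henstock_Kurzweil_Integration.integral_add)
qed

text \<open>The translation is moved onto the test function, followed by integration by parts over
  one period. \<open>F 0 = F 1\<close> says that \<open>f\<close> has no jump at the integers, so no
  boundary term arises; \<open>g\<close> may jump there.\<close>

lemma is_weak_deriv_shift:
  fixes f g F G :: "real \<Rightarrow> real"
  assumes f: "periodic_fun_simple' f" "\<And>z. z \<in> {0..<1} \<Longrightarrow> f z = F z"
    and g: "periodic_fun_simple' g" "\<And>z. z \<in> {0..<1} \<Longrightarrow> g z = G z"
    and F: "\<And>z. (F has_real_derivative G z) (at z)" "continuous_on {0..1} G" "F 0 = F 1"
  shows "is_weak_deriv (\<lambda>x. f (x + \<tau>)) (\<lambda>x. g (x + \<tau>))"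
  unfolding is_weak_deriv_def
proof (intro allI impI, elim conjE)
  fix \<psi> :: "real \<Rightarrow> real" assume \<psi>: "smooth \<psi>" "periodic_fun_simple' \<psi>"
  define \<theta> where "\<theta> z = \<psi> (z - \<tau>)" for z
  define \<theta>' where "\<theta>' z = deriv \<psi> (z - \<tau>)" for z
  have d\<theta>: "(\<theta> has_real_derivative \<theta>' z) (at z)" for z
    unfolding \<theta>_def \<theta>'_def
    using smooth_real_deriv(1)[OF \<psi>(1), of "z - \<tau>"] DERIV_shift[of \<psi> "deriv \<psi> (z - \<tau>)" z "- \<tau>"]
    by simp
  have p\<theta>: "periodic_fun_simple' \<theta>"
    using periodic_shift[OF \<psi>(2), of "- \<tau>"] by (simp add: \<theta>_def[abs_def])
  \<comment> \<open>The derivative of a periodic function is periodic, by uniqueness of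
    derivatives.\<close>
  have "\<theta>' (z + 1) = \<theta>' z" for z
  proof (rule DERIV_unique[OF _ d\<theta>])
    show "(\<theta> has_real_derivative \<theta>' (z + 1)) (at z)"
      using d\<theta>[of "z + 1"] DERIV_shift[of \<theta> "\<theta>' (z + 1)" z 1] p\<theta>
      by (simp add: periodic_fun_simple'_def)
  qed
  then have p\<theta>': "periodic_fun_simple' \<theta>'" by (simp add: periodic_fun_simple'_def)
  have c\<theta>': "continuous_on {0..1} \<theta>'"
    unfolding \<theta>'_def by (intro continuous_on_compose2[OF smooth_real_deriv(2)[OF \<psi>(1), of UNIV]] continuous_intros) auto
  have c\<theta>: "continuous_on {0..1} \<theta>" "continuous_on {0..1} F"
    by (metis d\<theta> F(1) DERIV_continuous_on has_field_derivative_at_within)+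
  have "(LINT x|circle. f (x + \<tau>) * deriv \<psi> x) = (LINT x|circle. (\<lambda>z. f z * \<theta>' z) (x + \<tau>))"
    by (simp add: \<theta>'_def)
  also have "\<dots> = integral {0..1} (\<lambda>z. F z * \<theta>' z)"
    by (rule periodic_circle_integral_shift(2))
       (use f p\<theta>' c\<theta> c\<theta>' in \<open>auto simp: periodic_fun_simple'_def intro!: continuous_intros\<close>)
  also have "\<dots> = - integral {0..1} (\<lambda>z. G z * \<theta> z)"
    using p\<theta> F(3)
    by (intro integral_by_parts_0_1 F(1,2) d\<theta> c\<theta>') (auto simp: periodic_fun_simple'_def dest: spec[of _ 0])
  also have "integral {0..1} (\<lambda>z. G z * \<theta> z) = (LINT x|circle. (\<lambda>z. g z * \<theta> z) (x + \<tau>))"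
    by (rule periodic_circle_integral_shift(2)[symmetric])
       (use g p\<theta> c\<theta> F in \<open>auto simp: periodic_fun_simple'_def intro!: continuous_intros\<close>)
  also have "\<dots> = (LINT x|circle. g (x + \<tau>) * \<psi> x)"
    by (simp add: \<theta>_def)
  finally show "(LINT x|circle. f (x + \<tau>) * deriv \<psi> x) = - (LINT x|circle. g (x + \<tau>) * \<psi> x)" .
qed

lemma W13_norm_eq:
  assumes "g \<in> L3" "is_weak_deriv f g"
  shows "W13_norm f = root 3 ((LINT x|circle. \<bar>f x\<bar> ^ 3) + (LINT x|circle. \<bar>g x\<bar> ^ 3))"
proof -
  have "(LINT x|circle. \<bar>weak_deriv f x\<bar> ^ 3) = (LINT x|circle. \<bar>g x\<bar> ^ 3)"
    by (rule circle_integral_AE_eq(2))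
       (use weak_deriv_AE(2)[OF assms] assms(1) in \<open>auto simp: L3_def\<close>)
  then show ?thesis by (simp add: W13_norm_def)
qed

lemma is_weak_deriv_diff:
  assumes "f1 \<in> L3" "f2 \<in> L3" "g1 \<in> L3" "g2 \<in> L3" "is_weak_deriv f1 g1" "is_weak_deriv f2 g2"
  shows "is_weak_deriv (\<lambda>x. f1 x - f2 x) (\<lambda>x. g1 x - g2 x)"
  unfolding is_weak_deriv_def
proof (intro allI impI, elim conjE)
  fix \<psi> :: "real \<Rightarrow> real" assume \<psi>: "smooth \<psi>" "periodic_fun_simple' \<psi>"
  have 1: "integrable circle (\<lambda>x. f x * deriv \<psi> x)" "integrable circle (\<lambda>x. f x * \<psi> x)" if "f \<in> L3" for f
    by (rule integrable_circle_mult_continuous[OF L3_integrable[OF that]],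
        rule smooth_real_deriv[OF \<psi>(1)] smooth_continuous_on[OF \<psi>(1)])+
  have "(LINT x|circle. f1 x * deriv \<psi> x) = - (LINT x|circle. g1 x * \<psi> x)"
       "(LINT x|circle. f2 x * deriv \<psi> x) = - (LINT x|circle. g2 x * \<psi> x)"
    using assms(5,6) \<psi> by (auto simp: is_weak_deriv_def)
  then show "(LINT x|circle. (f1 x - f2 x) * deriv \<psi> x) = - (LINT x|circle. (g1 x - g2 x) * \<psi> x)"
    using 1 assms by (simp add: left_diff_distrib)
qed

lemma L3_bounded:
  assumes "periodic_fun_simple' f" "f \<in> borel_measurable circle" "\<And>x. \<bar>f x\<bar> \<le> B"
  shows "f \<in> L3"
proof -
  interpret finite_measure circle by (rule finite_measure_circle)
  have "integrable circle (\<lambda>x. \<bar>f x\<bar> ^ 3)"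
    by (rule integrable_const_bound[of _ "B ^ 3"])
       (use assms(2,3) in \<open>auto intro!: AE_I2 power_mono simp: power_abs\<close>)
  with assms show ?thesis by (simp add: L3_def)
qed

section \<open>The peaked profile\<close>

text \<open>The variable \<zeta> of the peaked function, with values in \<open>(-1/2, 1/2]\<close>
  and jumps at the integers. The profile and its derivative are both continuous functions of
  it.\<close>

definition saw :: "real \<Rightarrow> real" where
  "saw x = 1/2 - x + of_int \<lfloor>x\<rfloor>"

lemma saw_bound: "\<bar>saw x\<bar> \<le> 1/2"
  unfolding saw_def by linarith

lemma saw_plus_1 [simp]: "saw (x + 1) = saw x"
  by (simp add: saw_def)

lemma saw_eq: "z \<in> {0..<1} \<Longrightarrow> saw z = 1/2 - z"
  by (auto simp: saw_def floor_eq_iff)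

lemma saw_frac: "saw x = 1/2 - frac x"
  by (simp add: saw_def frac_def)

lemma isCont_saw: "x \<notin> \<int> \<Longrightarrow> isCont saw x"
  unfolding saw_def isCont_def by (intro tendsto_intros tendsto_of_int_floor)

lemma measurable_saw [measurable]: "saw \<in> borel_measurable borel"
  unfolding saw_def by measurable

lemma AE_circle_shift_notin_Ints: "AE x in circle. x + \<tau> \<notin> \<int>"
proof -
  have "{x \<in> {0..1}. x + \<tau> \<in> \<int>} \<subseteq> (\<lambda>n. n - \<tau>) ` \<int>" by force
  moreover have "countable ((\<lambda>n. n - \<tau>) ` (\<int> :: real set))"
    by (intro countable_image) (simp add: Ints_def)
  ultimately show ?thesis
    unfolding AE_circle_iff_negligible 
    by (metis countable_imp_null_set_lborel countable_subset negligible_iff_null_sets null_sets_completionI)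
qed

lemma borel_measurable_lebesgue_on:
  fixes f :: "real \<Rightarrow> real"
  assumes "f \<in> borel_measurable borel" shows "f \<in> borel_measurable (lebesgue_on S)"
  using assms by (intro measurable_restrict_space1 measurable_completion) simp

text \<open>\<open>saw\<close> is continuous off the integers, so the integrand tends to 0 almost
  everywhere and dominated convergence applies. One statement serves both the profile and its
  discontinuous derivative.\<close>

lemma tendsto_circle_integral_saw:
  fixes k :: "real \<Rightarrow> real" and \<tau> :: "nat \<Rightarrow> real"
  assumes k: "continuous_on UNIV k" and \<tau>: "\<tau> \<longlonglongrightarrow> \<sigma>"
  shows "(\<lambda>n. LINT x|circle. \<bar>k (saw (x + \<tau> n)) - k (saw (x + \<sigma>))\<bar> ^ 3) \<longlonglongrightarrow> 0"
proof -
  interpret finite_measure circle by (rule finite_measure_circle)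
  have [measurable]: "k \<in> borel_measurable borel"
    using k by (rule borel_measurable_continuous_onI)
  \<comment> \<open>\<open>k\<close> may be unbounded on the line, but \<open>saw\<close> takes
    values in this compact interval only.\<close>
  have "compact (k ` {-1/2..1/2})"
    using k by (intro compact_continuous_image) (auto intro: continuous_on_subset)
  then obtain B where B: "\<And>s. s \<in> {-1/2..1/2} \<Longrightarrow> \<bar>k s\<bar> \<le> B"
    using compact_imp_bounded[of "k ` {-1/2..1/2}"] unfolding bounded_iff
    by (metis image_eqI real_norm_def)
  have B: "\<bar>k (saw x)\<bar> \<le> B" for x
    using saw_bound[of x] by (intro B) auto
  have "(\<lambda>n. LINT x|circle. \<bar>k (saw (x + \<tau> n)) - k (saw (x + \<sigma>))\<bar> ^ 3) \<longlonglongrightarrow> (LINT x|circle. 0)"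
  proof (rule integral_dominated_convergence)
    show "(\<lambda>x. \<bar>k (saw (x + \<tau> n)) - k (saw (x + \<sigma>))\<bar> ^ 3) \<in> borel_measurable circle" for n
      by (rule borel_measurable_lebesgue_on) measurable
    show "integrable circle (\<lambda>x. (2 * B) ^ 3)" by simp
    show "AE x in circle. (\<lambda>n. \<bar>k (saw (x + \<tau> n)) - k (saw (x + \<sigma>))\<bar> ^ 3) \<longlonglongrightarrow> 0"
      using AE_circle_shift_notin_Ints[of \<sigma>]
    proof eventually_elim
      case (elim x)
      have "isCont k (saw (x + \<sigma>))" using k by (simp add: continuous_on_eq_continuous_at)
      then have "(\<lambda>n. k (saw (x + \<tau> n))) \<longlonglongrightarrow> k (saw (x + \<sigma>))"
        by (intro isCont_tendsto_compose[of _ k] isCont_tendsto_compose[OF isCont_saw[OF elim]]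
            tendsto_intros \<tau>)
      then have "(\<lambda>n. \<bar>k (saw (x + \<tau> n)) - k (saw (x + \<sigma>))\<bar> ^ 3) \<longlonglongrightarrow> \<bar>k (saw (x + \<sigma>)) - k (saw (x + \<sigma>))\<bar> ^ 3"
        by (intro tendsto_intros)
      then show ?case by simp
    qed
    show "AE x in circle. norm (\<bar>k (saw (x + \<tau> n)) - k (saw (x + \<sigma>))\<bar> ^ 3) \<le> (2 * B) ^ 3" for n
    proof (intro AE_I2)
      fix x
      have "\<bar>k (saw (x + \<tau> n)) - k (saw (x + \<sigma>))\<bar> \<le> 2 * B"
        using B[of "x + \<tau> n"] B[of "x + \<sigma>"] by linarith
      from power_mono[OF this, of 3]
      show "norm (\<bar>k (saw (x + \<tau> n)) - k (saw (x + \<sigma>))\<bar> ^ 3) \<le> (2 * B) ^ 3"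
        by simp
    qed
  qed auto
  then show ?thesis by simp
qed

section \<open>The peak as a curve in \<open>W13\<close>\<close>

definition peak :: "real \<Rightarrow> real \<Rightarrow> real" where "peak a x = a * cosh (saw x)"
text \<open>The minus sign reflects that \<open>saw\<close> has slope -1 between integers.\<close>

definition dpeak :: "real \<Rightarrow> real \<Rightarrow> real" where "dpeak a x = - (a * sinh (saw x))"

lemma peak_periodic: "periodic_fun_simple' (peak a)" "periodic_fun_simple' (dpeak a)"
  by (simp_all add: periodic_fun_simple'_def peak_def dpeak_def)

lemma peak_L3: "(\<lambda>x. peak a (x + \<tau>)) \<in> L3"
  by (rule L3_shift[OF peak_periodic(1), where F = "\<lambda>z. a * cosh (1/2 - z)"])
     (auto simp: peak_def saw_eq intro!: continuous_intros)

lemma dpeak_L3: "(\<lambda>x. dpeak a (x + \<tau>)) \<in> L3"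
  by (rule L3_shift[OF peak_periodic(2), where F = "\<lambda>z. - (a * sinh (1/2 - z))"])
     (auto simp: dpeak_def saw_eq intro!: continuous_intros)

lemma is_weak_deriv_peak: "is_weak_deriv (\<lambda>x. peak a (x + \<tau>)) (\<lambda>x. dpeak a (x + \<tau>))"
proof (rule is_weak_deriv_shift[where F = "\<lambda>z. a * cosh (1/2 - z)" and G = "\<lambda>z. - (a * sinh (1/2 - z))"])
  show "a * cosh (1/2 - 0) = a * cosh (1/2 - (1::real))"
    using cosh_minus[of "1/2 :: real"] by simp
qed (auto simp: peak_periodic[unfolded peak_def[abs_def] dpeak_def[abs_def]] peak_def dpeak_def saw_eq intro!: continuous_intros derivative_eq_intros)

lemma peak_W13: "(\<lambda>x. peak a (x + \<tau>)) \<in> W13"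
  using peak_L3 dpeak_L3 is_weak_deriv_peak unfolding W13_def by blast

text \<open>The two translates jump at different places, so a formula on a single period is
  inconvenient; boundedness is used instead.\<close>

lemma dpeak_diff_L3: "(\<lambda>x. dpeak a (x + \<tau>) - dpeak a (x + \<sigma>)) \<in> L3"
proof (rule L3_bounded)
  have "\<bar>dpeak a x\<bar> \<le> \<bar>a\<bar> * sinh (1/2)" for x
  proof -
    have "sinh \<bar>saw x\<bar> \<le> sinh (1/2)" using saw_bound[of x] by (simp only: sinh_real_le_iff)
    then show ?thesis by (auto simp: dpeak_def abs_mult intro!: mult_left_mono simp flip: sinh_real_abs)
  qed
  then show "\<bar>dpeak a (x + \<tau>) - dpeak a (x + \<sigma>)\<bar> \<le> 2 * (\<bar>a\<bar> * sinh (1/2))" for x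
    by (smt (verit))
qed (use dpeak_L3[of a \<tau>] dpeak_L3[of a \<sigma>] in \<open>auto simp: L3_def periodic_fun_simple'_def\<close>)

text \<open>Continuity of translation along the peak; it supplies the limit in strong
  measurability.\<close>

lemma tendsto_W13_norm_peak:
  assumes \<tau>: "\<tau> \<longlonglongrightarrow> \<sigma>"
  shows "(\<lambda>n. W13_norm (\<lambda>x. peak a (x + \<tau> n) - peak a (x + \<sigma>))) \<longlonglongrightarrow> 0"
proof -
  have "W13_norm (\<lambda>x. peak a (x + \<tau> n) - peak a (x + \<sigma>)) =
      root 3 ((LINT x|circle. \<bar>peak a (x + \<tau> n) - peak a (x + \<sigma>)\<bar> ^ 3)
        + (LINT x|circle. \<bar>dpeak a (x + \<tau> n) - dpeak a (x + \<sigma>)\<bar> ^ 3))" for n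
    by (intro W13_norm_eq dpeak_diff_L3 is_weak_deriv_diff peak_L3 dpeak_L3 is_weak_deriv_peak)
  moreover have "(\<lambda>n. LINT x|circle. \<bar>peak a (x + \<tau> n) - peak a (x + \<sigma>)\<bar> ^ 3) \<longlonglongrightarrow> 0"
    unfolding peak_def by (rule tendsto_circle_integral_saw[OF _ \<tau>]) (intro continuous_intros)
  moreover have "(\<lambda>n. LINT x|circle. \<bar>dpeak a (x + \<tau> n) - dpeak a (x + \<sigma>)\<bar> ^ 3) \<longlonglongrightarrow> 0"
    unfolding dpeak_def by (rule tendsto_circle_integral_saw[OF _ \<tau>]) (intro continuous_intros)
  ultimately show ?thesis
    using tendsto_real_root[OF tendsto_add, of _ 0 sequentially _ 0 3] by simp
qed

text \<open>Both integrals reduce to one period and lose the shift. This yields a bound on the norm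
  that is uniform in time.\<close>

lemma W13_norm_peak_const: "W13_norm (\<lambda>x. peak a (x + \<tau>)) = W13_norm (peak a)"
proof -
  have 1: "W13_norm (\<lambda>x. peak a (x + \<tau>)) = root 3 (integral {0..1} (\<lambda>z. \<bar>a * cosh (1/2 - z)\<bar> ^ 3)
      + integral {0..1} (\<lambda>z. \<bar>a * sinh (1/2 - z)\<bar> ^ 3))" for \<tau>
  proof -
    have "(LINT x|circle. (\<lambda>z. \<bar>peak a z\<bar> ^ 3) (x + \<tau>)) = integral {0..1} (\<lambda>z. \<bar>a * cosh (1/2 - z)\<bar> ^ 3)"
      by (rule periodic_circle_integral_shift(2))
         (auto simp: peak_def saw_eq periodic_fun_simple'_def intro!: continuous_intros)
    moreover have "(LINT x|circle. (\<lambda>z. \<bar>dpeak a z\<bar> ^ 3) (x + \<tau>)) = integral {0..1} (\<lambda>z. \<bar>a * sinh (1/2 - z)\<bar> ^ 3)"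
      by (rule periodic_circle_integral_shift(2))
         (auto simp: dpeak_def saw_eq periodic_fun_simple'_def intro!: continuous_intros)
    ultimately show ?thesis
      by (simp add: W13_norm_eq[OF dpeak_L3 is_weak_deriv_peak])
  qed
  show ?thesis using 1[of \<tau>] 1[of 0] by simp
qed

text \<open>Time is rounded down to a grid of mesh \<open>1/(n+1)\<close>. On a bounded interval
  this leaves finitely many translates, which converge by continuity of translation.\<close>

lemma strongly_measurable_peak:
  "strongly_measurable_W13 T (\<lambda>t x. peak a (x - c * t))"
  unfolding strongly_measurable_W13_def
proof (intro exI conjI allI ballI)
  define r where "r n t = real_of_int \<lfloor>real (Suc n) * t\<rfloor> / real (Suc n)" for n t
  let ?s = "\<lambda>n t x. peak a (x - c * r n t)"
  fix n
  show "?s n t \<in> W13" for t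
    using peak_W13[of a "- (c * r n t)"] by simp
  have "simple_function (lebesgue_on {0..<T}) (r n)"
    unfolding simple_function_def
  proof
    have "r n ` {0..<T} \<subseteq> (\<lambda>i. real_of_int i / real (Suc n)) ` {0..\<lfloor>real (Suc n) * T\<rfloor>}"
      unfolding r_def by (auto intro!: imageI floor_mono mult_left_mono)
    then show "finite (r n ` space (lebesgue_on {0..<T}))"
      by (simp add: finite_subset)
    have "r n \<in> borel_measurable borel"
      unfolding r_def by measurable
    then have "r n \<in> borel_measurable (lebesgue_on {0..<T})"
      by (rule borel_measurable_lebesgue_on)
    then show "\<forall>x\<in>r n ` space (lebesgue_on {0..<T}). r n -` {x} \<inter> space (lebesgue_on {0..<T}) \<in> sets (lebesgue_on {0..<T})"
      by (intro ballI measurable_sets[of _ _ borel]) auto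
  qed
  then have "simple_function (lebesgue_on {0..<T}) ((\<lambda>q x. peak a (x - c * q)) \<circ> r n)"
    by (rule simple_function_compose)
  then show "simple_function (lebesgue_on {0..<T}) (?s n)" by (simp add: comp_def)
next
  define r where "r n t = real_of_int \<lfloor>real (Suc n) * t\<rfloor> / real (Suc n)" for n t
  have "(\<lambda>n. W13_norm (\<lambda>x. peak a (x - c * r n t) - peak a (x - c * t))) \<longlonglongrightarrow> 0" for t
  proof -
    have "(\<lambda>n. r n t) \<longlonglongrightarrow> t"
    proof (rule tendsto_sandwich[of "\<lambda>n. t - inverse (real (Suc n))" _ _ "\<lambda>_. t"])
      show "(\<lambda>n. t - inverse (real (Suc n))) \<longlonglongrightarrow> t"
        using tendsto_diff[OF tendsto_const[of t] LIMSEQ_inverse_real_of_nat] by simp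
      have "t - inverse (real (Suc n)) \<le> r n t \<and> r n t \<le> t" for n
      proof -
        have "t - inverse (real (Suc n)) = (real (Suc n) * t - 1) / real (Suc n)"
          by (simp add: field_simps)
        also have "\<dots> \<le> r n t"
          unfolding r_def by (intro divide_right_mono) linarith+
        finally have "t - inverse (real (Suc n)) \<le> r n t" .
        moreover have "r n t \<le> real (Suc n) * t / real (Suc n)"
          unfolding r_def by (intro divide_right_mono) linarith+
        ultimately show ?thesis by simp
      qed
      then show "\<forall>\<^sub>F n in sequentially. t - inverse (real (Suc n)) \<le> r n t"
        "\<forall>\<^sub>F n in sequentially. r n t \<le> t" by simp_all
    qed auto
    then have "(\<lambda>n. - (c * r n t)) \<longlonglongrightarrow> - (c * t)"
      by (intro tendsto_intros)
    from tendsto_W13_norm_peak[OF this, of a] show ?thesis by simp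
  qed
  then show "AE t in lebesgue_on {0..<T}. (\<lambda>n. W13_norm (\<lambda>x. peak a (x - c * (real_of_int \<lfloor>real (Suc n) * t\<rfloor> / real (Suc n))) - peak a (x - c * t))) \<longlonglongrightarrow> 0"
    by (intro AE_I2) (simp add: r_def)
qed

lemma peak_Linf_loc_W13: "(\<lambda>t x. peak a (x - c * t)) \<in> Linf_loc_W13 T"
proof -
  have "(\<lambda>x. peak a (x - c * t)) \<in> W13" "W13_norm (\<lambda>x. peak a (x - c * t)) = W13_norm (peak a)" for t
    using peak_W13[of a "- (c * t)"] W13_norm_peak_const[of a "- (c * t)"] by simp_all
  then show ?thesis
    using strongly_measurable_peak unfolding Linf_loc_W13_def
    by (auto intro!: AE_I2 exI[of _ "W13_norm (peak a)"])
qed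

section \<open>The weak formulation\<close>

text \<open>Recasts smoothness as a total derivative with continuous partials, as required for the
  chain rule along slanted lines and for differentiation under the integral.\<close>

lemma smooth_partial_derivatives:
  fixes \<phi> :: "real \<times> real \<Rightarrow> real"
  assumes "smooth \<phi>"
  obtains D1 D2 where
    "continuous_on UNIV \<phi>" "continuous_on UNIV D1" "continuous_on UNIV D2"
    "\<And>p. (\<phi> has_derivative (\<lambda>h. fst h * D1 p + snd h * D2 p)) (at p)"
proof
  have *: "times_cont_differentiable 1 \<phi>"
    using assms by (auto simp: smooth_def)
  define D where "D v p = frechet_derivative \<phi> (at p) v" for v p
  have d: "(\<phi> has_derivative (\<lambda>v. D v p)) (at p)" for p
    unfolding D_def using * by (subst frechet_derivative_works[symmetric]) (simp del: split_paired_All)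
  have c: "continuous_on UNIV (D v)" for v
    using * by (simp add: D_def[abs_def] del: split_paired_All)
  show "continuous_on UNIV (D (1, 0))" "continuous_on UNIV (D (0, 1))" by (rule c)+
  show "continuous_on UNIV \<phi>" by (rule smooth_continuous_on[OF assms])
  fix p
  interpret bounded_linear "\<lambda>v. D v p" using d by (rule has_derivative_bounded_linear)
  have "D h p = fst h * D (1, 0) p + snd h * D (0, 1) p" for h
  proof -
    have "h = fst h *\<^sub>R (1, 0) + snd h *\<^sub>R (0, 1)" by (simp add: prod_eq_iff)
    then have "D h p = D (fst h *\<^sub>R (1, 0) + snd h *\<^sub>R (0, 1)) p" by simp
    also have "\<dots> = fst h * D (1, 0) p + snd h * D (0, 1) p"
      by (simp only: add scaleR real_scaleR_def)
    finally show ?thesis .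
  qed
  then have "(\<lambda>v. D v p) = (\<lambda>h. fst h * D (1, 0) p + snd h * D (0, 1) p)" by blast
  with d[of p] show "(\<phi> has_derivative (\<lambda>h. fst h * D (1, 0) p + snd h * D (0, 1) p)) (at p)"
    by simp
qed

section \<open>Closed forms of the two convolutions\<close>

lemma peak_weak_deriv:
  "periodic_fun_simple' (weak_deriv (\<lambda>x. peak a (x + \<tau>)))"
  "AE y in circle. weak_deriv (\<lambda>x. peak a (x + \<tau>)) y = dpeak a (y + \<tau>)"
  using weak_deriv_AE[OF dpeak_L3 is_weak_deriv_peak] by (auto simp: L3_def)

text \<open>
  On \<open>[0,1]\<close> these solve \<open>F - F'' = p\<^sup>3 + 3/2 p p'\<^sup>2\<close> and \<open>F - F'' = p'\<^sup>3/2\<close>. The coefficient of the homogeneous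
  solution \<open>cosh s\<close> resp. \<open>sinh s\<close> is fixed by \<open>F'(0) = F'(1)\<close> resp. \<open>F(0) = F(1)\<close>; the other periodicity
  condition holds since \<open>F\<close> is even resp. odd in \<open>s\<close>.
\<close>

definition conv_even :: "real \<Rightarrow> real \<Rightarrow> real" where
  "conv_even a z = (let s = 1/2 - z; C = cosh (1/2); S = sinh (1/2) in
     a ^ 3 * ((15/16 * C\<^sup>2 + 3/16 + 3/32 * C / S) * cosh s - 5/16 * cosh s ^ 3 - 3/16 * s * sinh s))"

definition conv_odd :: "real \<Rightarrow> real \<Rightarrow> real" where
  "conv_odd a z = (let s = 1/2 - z; C = cosh (1/2); S = sinh (1/2) in
     a ^ 3 * ((3/32 * C / S - S\<^sup>2 / 16) * sinh s + 1/16 * sinh s ^ 3 - 3/16 * s * cosh s))"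

lemma circle_conv_even:
  "circle_conv green (\<lambda>y. peak a (y + \<tau>) ^ 3
      + 3/2 * peak a (y + \<tau>) * weak_deriv (\<lambda>x. peak a (x + \<tau>)) y ^ 2) x
    = conv_even a (frac (x + \<tau>))"
proof -
  \<comment> \<open>The coefficient of \<open>cosh s\<close> in \<open>conv_even\<close>. It stays
    opaque in the differential equation; its value enters only in
    \<open>?G 0 = ?G 1\<close>.\<close>
  define K :: real where "K = 15/16 * (cosh (1/2))\<^sup>2 + 3/16 + 3/32 * cosh (1/2) / sinh (1/2)"
  let ?P = "\<lambda>z. a ^ 3 * (cosh (1/2 - z) ^ 3 + 3/2 * cosh (1/2 - z) * sinh (1/2 - z) ^ 2)"
  let ?G = "\<lambda>z. a ^ 3 * (15/16 * cosh (1/2 - z) ^ 2 * sinh (1/2 - z)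
      + 3/16 * (sinh (1/2 - z) + (1/2 - z) * cosh (1/2 - z)) - K * sinh (1/2 - z))"
  show ?thesis
  proof (rule circle_conv_green[where P = ?P and G = ?G])
    show "periodic_fun_simple' (\<lambda>y. peak a (y + \<tau>) ^ 3
        + 3/2 * peak a (y + \<tau>) * weak_deriv (\<lambda>x. peak a (x + \<tau>)) y ^ 2)"
      using periodic_shift[OF peak_periodic(1)[of a], of \<tau>] peak_weak_deriv(1)[of a \<tau>]
      by (simp add: periodic_fun_simple'_def)
    show "AE y in circle. peak a (y + \<tau>) ^ 3
        + 3/2 * peak a (y + \<tau>) * weak_deriv (\<lambda>x. peak a (x + \<tau>)) y ^ 2 = ?P (frac (y + \<tau>))"
      using peak_weak_deriv(2)[of a \<tau>]
    proof eventually_elim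
      case (elim y)
      show ?case
        unfolding elim unfolding peak_def dpeak_def saw_frac by algebra
    qed
    show "continuous_on UNIV ?P" by (intro continuous_intros)
    show "(conv_even a has_real_derivative ?G z) (at z)" for z
      unfolding conv_even_def[abs_def] Let_def K_def[symmetric]
      by ((rule derivative_eq_intros refl numeral_neq_zero)+, simp, algebra)
    show "(?G has_real_derivative conv_even a z - ?P z) (at z)" for z
      unfolding conv_even_def Let_def K_def[symmetric]
      by ((rule derivative_eq_intros refl numeral_neq_zero)+, simp, use cosh_square_eq[of "1/2 - z"] in algebra)
    show "conv_even a 0 = conv_even a 1"
      using cosh_minus[of "1/2 :: real"] sinh_minus[of "1/2 :: real"] by (simp add: conv_even_def Let_def)
    have "K * sinh (1/2) = 15/16 * (cosh (1/2))\<^sup>2 * sinh (1/2) + 3/16 * sinh (1/2) + 3/32 * cosh (1/2)"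
      by (simp add: K_def field_simps)
    moreover have "(1/2 - 1 :: real) = - (1/2)" by simp
    ultimately show "?G 0 = ?G 1"
      by (simp only: cosh_minus sinh_minus diff_zero) algebra
  qed
qed

lemma circle_conv_odd:
  "circle_conv green (\<lambda>y. weak_deriv (\<lambda>x. peak a (x + \<tau>)) y ^ 3 / 2) x = conv_odd a (frac (x + \<tau>))"
proof -
  \<comment> \<open>The coefficient of \<open>sinh s\<close> in \<open>conv_odd\<close>, opaque in
    the differential equation.\<close>
  define L :: real where "L = 3/32 * cosh (1/2) / sinh (1/2) - (sinh (1/2))\<^sup>2 / 16"
  let ?P = "\<lambda>z. a ^ 3 * (- (1/2) * sinh (1/2 - z) ^ 3)"
  let ?G = "\<lambda>z. a ^ 3 * (3/16 * (cosh (1/2 - z) + (1/2 - z) * sinh (1/2 - z))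
      - L * cosh (1/2 - z) - 3/16 * sinh (1/2 - z) ^ 2 * cosh (1/2 - z))"
  show ?thesis
  proof (rule circle_conv_green[where P = ?P and G = ?G])
    show "periodic_fun_simple' (\<lambda>y. weak_deriv (\<lambda>x. peak a (x + \<tau>)) y ^ 3 / 2)"
      using peak_weak_deriv(1)[of a \<tau>] by (simp add: periodic_fun_simple'_def)
    show "AE y in circle. weak_deriv (\<lambda>x. peak a (x + \<tau>)) y ^ 3 / 2 = ?P (frac (y + \<tau>))"
      using peak_weak_deriv(2)[of a \<tau>]
    proof eventually_elim
      case (elim y)
      show ?case
        unfolding elim unfolding dpeak_def saw_frac by algebra
    qed
    show "continuous_on UNIV ?P" by (intro continuous_intros)
    show "(conv_odd a has_real_derivative ?G z) (at z)" for z
      unfolding conv_odd_def[abs_def] Let_def L_def[symmetric]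
      by ((rule derivative_eq_intros refl numeral_neq_zero)+, simp, algebra)
    show "(?G has_real_derivative conv_odd a z - ?P z) (at z)" for z
      unfolding conv_odd_def Let_def L_def[symmetric]
      by ((rule derivative_eq_intros refl numeral_neq_zero)+, simp, use cosh_square_eq[of "1/2 - z"] in algebra)
    \<comment> \<open>An odd function of \<open>s\<close> can agree at \<open>s = 1/2\<close> and
      \<open>s = -1/2\<close> only by vanishing at both, which the coefficient of
      \<open>sinh s\<close> achieves.\<close>
    have "conv_odd a 0 = 0" "conv_odd a 1 = 0"
      using cosh_minus[of "1/2 :: real"] sinh_minus[of "1/2 :: real"]
      by (simp_all add: conv_odd_def Let_def field_simps power2_eq_square power3_eq_cube)
    then show "conv_odd a 0 = conv_odd a 1" by simp
    show "?G 0 = ?G 1"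
      using cosh_minus[of "1/2 :: real"] sinh_minus[of "1/2 :: real"] by simp
  qed
qed

text \<open>The terms in \<open>s * sinh s\<close> and \<open>s * cosh s\<close> match by
  themselves. The relation between \<open>a\<close> and \<open>c\<close> is what makes the
  coefficients of \<open>sinh s\<close> agree, since it turns
  \<open>15/16 * C\<^sup>2 - C\<^sup>2\<close> into \<open>- C\<^sup>2 / 16\<close>.\<close>

lemma peak_flux_derivative:
  assumes "a\<^sup>2 = c / (cosh (1/2))\<^sup>2"
  shows "((\<lambda>z. 1/3 * (a * cosh (1/2 - z)) ^ 3 + conv_even a z - c * (a * cosh (1/2 - z)))
    has_real_derivative - conv_odd a z) (at z)"
proof -
  \<comment> \<open>Naming the quotient as \<open>\<kappa>\<close> leaves a polynomial identity, in
    which \<open>CS\<close> links the two constants.\<close>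
  define C S \<kappa> :: real where "C = cosh (1/2)" and "S = sinh (1/2)" and "\<kappa> = 3/32 * C / S"
  have c: "c = a\<^sup>2 * C\<^sup>2" using assms by (simp add: C_def)
  have CS: "C\<^sup>2 = S\<^sup>2 + 1" by (simp add: C_def S_def cosh_square_eq)
  show ?thesis
    unfolding conv_even_def conv_odd_def Let_def C_def[symmetric] S_def[symmetric] \<kappa>_def[symmetric] c
    by ((rule derivative_eq_intros refl numeral_neq_zero)+, simp, use cosh_square_eq[of "1/2 - z"] CS in algebra)
qed

section \<open>Assembly of the weak equation\<close>

lemma continuous_on_conv: "continuous_on A (conv_even a)" "continuous_on A (conv_odd a)"
  unfolding conv_even_def[abs_def] conv_odd_def[abs_def] Let_def by (intro continuous_intros; simp)+

lemma conv_even_0_1: "conv_even a 0 = conv_even a 1"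
  using cosh_minus[of "1/2 :: real"] sinh_minus[of "1/2 :: real"] by (simp add: conv_even_def Let_def)

lemma peak_novikov_identity:
  fixes a c T :: real and \<phi> :: "real \<times> real \<Rightarrow> real"
  assumes a: "a\<^sup>2 = c / (cosh (1/2))\<^sup>2" and T: "T > 0" and \<phi>: "test_function T \<phi>"
  shows "(LINT t|lebesgue_on {0..<T}. LINT x|circle.
           peak a (x - c * t) * deriv (\<lambda>s. \<phi> (s, x)) t
           + 1/3 * peak a (x - c * t) ^ 3 * deriv (\<lambda>y. \<phi> (t, y)) x
           + circle_conv green (\<lambda>y. peak a (y - c * t) ^ 3
               + 3/2 * peak a (y - c * t) * weak_deriv (\<lambda>x. peak a (x - c * t)) y ^ 2) x
               * deriv (\<lambda>y. \<phi> (t, y)) x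
           - circle_conv green (\<lambda>y. weak_deriv (\<lambda>x. peak a (x - c * t)) y ^ 3 / 2) x * \<phi> (t, x))
        + (LINT x|circle. peak a x * \<phi> (0, x)) = 0"
proof -
  have sm: "smooth \<phi>" and per: "\<And>t x. \<phi> (t, x + 1) = \<phi> (t, x)"
    using \<phi> by (auto simp: test_function_def periodic_fun_simple'_def)
  obtain K where K: "compact K" "K \<subseteq> {0..<T}" "\<And>t x. t \<in> {0..<T} - K \<Longrightarrow> \<phi> (t, x) = 0"
    using \<phi> unfolding test_function_def by blast
  obtain D1 D2 where c\<phi>: "continuous_on UNIV \<phi>"
    and cD: "continuous_on UNIV D1" "continuous_on UNIV D2"
    and D: "\<And>p. (\<phi> has_derivative (\<lambda>h. fst h * D1 p + snd h * D2 p)) (at p)"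
    using smooth_partial_derivatives[OF sm] by blast
  note [continuous_intros] = continuous_on_compose2[OF c\<phi> _ subset_UNIV]
    continuous_on_compose2[OF cD(1) _ subset_UNIV] continuous_on_compose2[OF cD(2) _ subset_UNIV]
  \<comment> \<open>With \<open>k = 0\<close> this is the plain time derivative, with
    \<open>k = c\<close> the derivative in the frame moving with the peak.\<close>
  have dt: "((\<lambda>s. \<phi> (s, x + k * s)) has_real_derivative D1 (t, x + k * t) + k * D2 (t, x + k * t)) (at t)"
    for x k t
  proof -
    have "((\<lambda>s. (s, x + k * s)) has_derivative (\<lambda>h. (h, k * h))) (at t)"
      by (auto intro!: derivative_eq_intros)
    from has_derivative_compose[OF this D] show ?thesis
      unfolding has_field_derivative_def
      by (rule has_derivative_eq_rhs) (simp add: fun_eq_iff algebra_simps)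
  qed
  have dx: "((\<lambda>y. \<phi> (t, y)) has_real_derivative D2 (t, x)) (at x)" for t x
  proof -
    have "((\<lambda>y. (t, y)) has_derivative (\<lambda>h. (0, h))) (at x)"
      by (auto intro!: derivative_eq_intros)
    from has_derivative_compose[OF this D] show ?thesis
      unfolding has_field_derivative_def
      by (rule has_derivative_eq_rhs) (simp add: fun_eq_iff algebra_simps)
  qed
  have p1: "D1 (t, x + 1) = D1 (t, x)" for t x
    using DERIV_unique[OF dt[of "x + 1" 0 t]] dt[of x 0 t] by (simp add: per)
  have p2: "D2 (t, x + 1) = D2 (t, x)" for t x
    using DERIV_unique[OF _ dx[of t x]] DERIV_shift[of "\<lambda>y. \<phi> (t, y)" "D2 (t, x + 1)" x 1] dx[of t "x + 1"]
    by (simp add: per)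
  have D_deriv: "deriv (\<lambda>s. \<phi> (s, x)) t = D1 (t, x)" "deriv (\<lambda>y. \<phi> (t, y)) x = D2 (t, x)" for t x
    using dt[of x 0 t] dx by (auto intro!: DERIV_imp_deriv)

  let ?p = "\<lambda>z. a * cosh (1/2 - z)"
  \<comment> \<open>In the moving frame only \<phi> depends on time, so differentiation under the
    integral never touches the corner of the profile.\<close>
  define I where "I t = integral {0..1} (\<lambda>z. ?p z * \<phi> (t, z + c * t))" for t
  define I' where "I' t = integral {0..1} (\<lambda>z. ?p z * (D1 (t, z + c * t) + c * D2 (t, z + c * t)))" for t
  have dI: "(I has_vector_derivative I' t) (at t)" for t
    unfolding I_def[abs_def] I'_def interval_cbox
    by (rule leibniz_rule_vector_derivative[where U = UNIV])
       (auto simp: split_beta has_real_derivative_iff_has_vector_derivative[symmetric]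
         intro!: DERIV_cmult dt integrable_continuous_interval continuous_intros)
  have cI': "continuous_on S I'" for S
  proof -
    have "continuous_on UNIV I'"
      unfolding I'_def[abs_def] interval_cbox
      by (rule integral_continuous_on_param)
         (auto simp: split_beta intro!: continuous_intros)
    then show ?thesis by (rule continuous_on_subset) simp
  qed

  have inner: "(LINT x|circle.
           peak a (x - c * t) * deriv (\<lambda>s. \<phi> (s, x)) t
           + 1/3 * peak a (x - c * t) ^ 3 * deriv (\<lambda>y. \<phi> (t, y)) x
           + circle_conv green (\<lambda>y. peak a (y - c * t) ^ 3
               + 3/2 * peak a (y - c * t) * weak_deriv (\<lambda>x. peak a (x - c * t)) y ^ 2) x
               * deriv (\<lambda>y. \<phi> (t, y)) x
           - circle_conv green (\<lambda>y. weak_deriv (\<lambda>x. peak a (x - c * t)) y ^ 3 / 2) x * \<phi> (t, x)) = I' t" for t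
  proof -
    let ?t1 = "\<lambda>z. D1 (t, z + c * t)" and ?t2 = "\<lambda>z. D2 (t, z + c * t)" and ?t0 = "\<lambda>z. \<phi> (t, z + c * t)"
    \<comment> \<open>The flux seen in the moving frame; \<open>- c * ?p\<close> arises from
      completing \<open>?t1\<close> to \<open>?t1 + c * ?t2\<close>.\<close>
    let ?W = "\<lambda>z. 1/3 * ?p z ^ 3 + conv_even a z - c * ?p z"
    define f where "f z = peak a z * ?t1 z + 1/3 * peak a z ^ 3 * ?t2 z
      + conv_even a (frac z) * ?t2 z - conv_odd a (frac z) * ?t0 z" for z
    have "(LINT x|circle.
           peak a (x - c * t) * deriv (\<lambda>s. \<phi> (s, x)) t
           + 1/3 * peak a (x - c * t) ^ 3 * deriv (\<lambda>y. \<phi> (t, y)) x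
           + circle_conv green (\<lambda>y. peak a (y - c * t) ^ 3
               + 3/2 * peak a (y - c * t) * weak_deriv (\<lambda>x. peak a (x - c * t)) y ^ 2) x
               * deriv (\<lambda>y. \<phi> (t, y)) x
           - circle_conv green (\<lambda>y. weak_deriv (\<lambda>x. peak a (x - c * t)) y ^ 3 / 2) x * \<phi> (t, x))
        = (LINT x|circle. f (x + - (c * t)))"
      using circle_conv_even[of a "- (c * t)"] circle_conv_odd[of a "- (c * t)"]
      by (simp add: f_def D_deriv)
    also have "\<dots> = integral {0..1} (\<lambda>z. ?p z * ?t1 z + 1/3 * ?p z ^ 3 * ?t2 z
      + conv_even a z * ?t2 z - conv_odd a z * ?t0 z)"
    proof (rule periodic_circle_integral_shift(2))
      have "z + 1 + c * t = (z + c * t) + 1" for z by simp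
      note shift = p1[of t "z + c * t" for z, folded this] p2[of t "z + c * t" for z, folded this]
        per[of t "z + c * t" for z, folded this]
      show "periodic_fun_simple' f"
        using peak_periodic(1)[of a]
        unfolding periodic_fun_simple'_def f_def by (simp add: shift frac_1_eq)
      show "continuous_on {0..1} (\<lambda>z. ?p z * ?t1 z + 1/3 * ?p z ^ 3 * ?t2 z
          + conv_even a z * ?t2 z - conv_odd a z * ?t0 z)"
        by (intro continuous_intros continuous_on_conv)
      show "f z = ?p z * ?t1 z + 1/3 * ?p z ^ 3 * ?t2 z
          + conv_even a z * ?t2 z - conv_odd a z * ?t0 z" if "z \<in> {0..<1}" for z
        using that frac_eq[of z] by (simp add: f_def peak_def saw_frac)
    qed
    also have "\<dots> = integral {0..1} (\<lambda>z. ?p z * (?t1 z + c * ?t2 z) + (?W z * ?t2 z + (- conv_odd a z) * ?t0 z))"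
      by (rule arg_cong[where f = "integral {0..1}"]) (auto simp: algebra_simps)
    also have "\<dots> = I' t + (integral {0..1} (\<lambda>z. ?W z * ?t2 z) + integral {0..1} (\<lambda>z. - conv_odd a z * ?t0 z))"
    proof -
      have i1: "(\<lambda>z. ?p z * (?t1 z + c * ?t2 z)) integrable_on {0..1}"
        by (intro integrable_continuous_interval continuous_intros continuous_on_conv)
      have i2: "(\<lambda>z. ?W z * ?t2 z) integrable_on {0..1}"
        by (intro integrable_continuous_interval continuous_intros continuous_on_conv)
      have i3: "(\<lambda>z. - conv_odd a z * ?t0 z) integrable_on {0..1}"
        by (intro integrable_continuous_interval continuous_intros continuous_on_conv)
      show ?thesis
        unfolding I'_def Henstock_Kurzweil_Integration.integral_add[OF i1 integrable_add[OF i2 i3]]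
          Henstock_Kurzweil_Integration.integral_add[OF i2 i3] ..
    qed
    \<comment> \<open>The flux and \<phi> take equal values at both ends of the period, so no
      boundary term remains and the result cancels the second convolution term.\<close>
    also have "integral {0..1} (\<lambda>z. ?W z * ?t2 z) = - integral {0..1} (\<lambda>z. - conv_odd a z * ?t0 z)"
    proof (rule integral_by_parts_0_1[OF peak_flux_derivative[OF a]])
      show "continuous_on {0..1} (\<lambda>z. - conv_odd a z)" "continuous_on {0..1} ?t2"
        by (intro continuous_intros continuous_on_conv)+
      show "(?t0 has_real_derivative ?t2 z) (at z)" for z
        using dx[of t "z + c * t"] DERIV_shift[of "\<lambda>y. \<phi> (t, y)" "?t2 z" z "c * t"] by simp
      show "?W 0 * ?t0 0 = ?W 1 * ?t0 1"
        using per[of t "c * t"] cosh_minus[of "1/2 :: real"] conv_even_0_1[of a] by (simp add: add.commute)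
    qed
    finally show ?thesis by simp
  qed

  \<comment> \<open>The support condition says nothing at \<open>T\<close> itself. As
    \<open>K\<close> is closed and misses \<open>T\<close>, \<phi> vanishes just to the left of
    \<open>T\<close>, and continuity gives the value there.\<close>
  have "\<phi> (T, x) = 0" for x
  proof (rule tendsto_unique[of "at_left T" "\<lambda>t. \<phi> (t, x)"])
    have "isCont (\<lambda>t. \<phi> (t, x)) T"
      using dt[of x 0 T] by (auto dest: DERIV_isCont)
    then show "((\<lambda>t. \<phi> (t, x)) \<longlongrightarrow> \<phi> (T, x)) (at_left T)"
      unfolding isCont_def by (rule filterlim_at_split[THEN iffD1, THEN conjunct1])
    have "\<forall>\<^sub>F t in nhds T. t \<in> - K"
      using K(1,2) by (intro eventually_nhds_in_open) (auto simp: compact_imp_closed open_Compl)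
    then have "\<forall>\<^sub>F t in at_left T. t \<in> - K"
      by (simp add: eventually_at_filter eventually_mono)
    moreover have "\<forall>\<^sub>F t in at_left T. t \<in> {0<..<T}"
      by (rule eventually_at_left_real[OF T])
    ultimately have "\<forall>\<^sub>F t in at_left T. \<phi> (t, x) = 0"
      by eventually_elim (use K(3) in auto)
    then show "((\<lambda>t. \<phi> (t, x)) \<longlongrightarrow> 0) (at_left T)"
      by (rule tendsto_eventually)
  qed simp
  then have IT: "I T = 0" by (simp add: I_def)
  have I0: "(LINT x|circle. peak a x * \<phi> (0, x)) = I 0"
  proof -
    have "(LINT x|circle. (\<lambda>x. peak a x * \<phi> (0, x)) (x + 0)) = integral {0..1} (\<lambda>z. ?p z * \<phi> (0, z))"
    proof (rule periodic_circle_integral_shift(2))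
      show "periodic_fun_simple' (\<lambda>x. peak a x * \<phi> (0, x))"
        using peak_periodic(1)[of a] by (simp add: periodic_fun_simple'_def per)
      show "continuous_on {0..1} (\<lambda>z. ?p z * \<phi> (0, z))"
        by (intro continuous_intros)
    qed (auto simp: peak_def saw_eq)
    then show ?thesis by (simp add: I_def)
  qed
  have "(LINT t|lebesgue_on {0..<T}. I' t) = integral {0..<T} I'"
  proof (rule lebesgue_integral_eq_integral)
    have "I' absolutely_integrable_on {0..T}"
      by (rule absolutely_integrable_continuous_real[OF cI'])
    then have "I' absolutely_integrable_on {0..<T}"
      by (rule set_integrable_subset) auto
    then show "integrable (lebesgue_on {0..<T}) I'"
      by (rule absolutely_integrable_imp_integrable) auto
  qed auto
  also have "\<dots> = integral {0..T} I'"
    by (rule integral_spike_set) (auto intro: negligible_subset[of "{T}"])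
  also have "\<dots> = I T - I 0"
    using T dI by (intro integral_unique fundamental_theorem_of_calculus)
      (auto intro: has_vector_derivative_at_within)
  finally show ?thesis
    unfolding inner I0 IT by simp
qed

theorem theorem3p1:
  fixes a c :: real and u :: "real \<Rightarrow> real \<Rightarrow> real"
  assumes "c > 0"
    and "a\<^sup>2 = c / (cosh (1/2))\<^sup>2"
    and "\<And>t x. u t x = a * cosh (1/2 - (x - c * t) + of_int \<lfloor>x - c * t\<rfloor>)"
  shows "global_periodic_weak_solution (u 0) u"
proof -
  have u: "u = (\<lambda>t x. peak a (x - c * t))"
    using assms(3) by (simp add: fun_eq_iff peak_def saw_def)
  show ?thesis
    unfolding global_periodic_weak_solution_def periodic_weak_solution_def u
  proof (intro allI impI conjI)
    show "(\<lambda>x. peak a (x - c * 0)) \<in> W13"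
      using peak_W13[of a 0] by simp
    show "(\<lambda>t x. peak a (x - c * t)) \<in> Linf_loc_W13 T" for T
      by (rule peak_Linf_loc_W13)
  qed (use peak_novikov_identity[OF assms(2)] in simp)
qed

end
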